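(* Let $\mathbb{E}$ be an elementary topos with suprema of chains of subobjects. Then the fibration $(\;)_0:PrO\,\mathbb{E}\to\mathbb{E}$ and its restriction $(\;)_0:Equ\,\mathbb{E}\to\mathbb{E}$ are cofibrations as well.
   Context: A chain of subobjects of $X$ is an increasing sequence $(A_i)_{i\in\mathbb{N}}$ of subobjects of $X$; its supremum is taken in the ordered set of subobjects of $X$. A relation on $X$ is (a class up to isomorphism of) a subobject $R\rightarrowtail X\times X$, ordered by inclusion. $R$ is reflexive if $\Delta_X\subset R$, symmetric if $R^{op}\subset R$, transitive if $R\circ R\subset R$; a preorder is a reflexive transitive relation, an equivalence relation is a symmetric preorder. For $f:X\to Y$ and a relation $S$ on $Y$, $f^{-1}(S)$ is the pullback of $S\rightarrowtail Y\times Y$ along $f\times f$. $PrO\,\mathbb{E}$ (resp. $Equ\,\mathbb{E}$) is the category whose objects are pairs (object $X$ of $\mathbb{E}$, internal preorder (resp. equivalence relation) $R$ on $X$) and in which a morphism $R\to S$ above $f:X\to Y$ exists (and is unique) iff $R\subset f^{-1}(S)$; $(\;)_0$ sends $R$ to its ground object $X$. It is a fibration whose cartesian maps are given by inverse images. Given a functor $U:\mathbb{C}\to\mathbb{D}$, a map $f:X\to Z$ of $\mathbb{C}$ is cocartesian with respect to $U$ when, for every $\phi:X\to W$ with $U(\phi)=U(f)$, there is a unique $\psi:Z\to W$ with $\psi f=\phi$ and $U(\psi)=1_{U(Z)}$. To say that the fibration $U$ is a cofibration as well means that, for every object $C$ of $\mathbb{C}$ and every map $g:U(C)\to D$ in $\mathbb{D}$,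 there is a cocartesian map with domain $C$ above $g$. *)

theory Defs
  imports Main
begin

section \<open>Categories and functors\<close>

record ('o, 'm) cat =
  Obj :: "'o set"
  Arr :: "'m set"
  Dom :: "'m \<Rightarrow> 'o"
  Cod :: "'m \<Rightarrow> 'o"
  Ide :: "'o \<Rightarrow> 'm"
  Comp :: "'m \<Rightarrow> 'm \<Rightarrow> 'm" (infixr "\<cdot>\<index>" 70)

definition hom :: "('o, 'm) cat \<Rightarrow> 'o \<Rightarrow> 'o \<Rightarrow> 'm set" where
  "hom C X Y = {f \<in> Arr C. Dom C f = X \<and> Cod C f = Y}"

locale category =
  fixes C :: "('o, 'm) cat" (structure)
  assumes Dom_Obj: "f \<in> Arr C \<Longrightarrow> Dom C f \<in> Obj C"
    and Cod_Obj: "f \<in> Arr C \<Longrightarrow> Cod C f \<in> Obj C"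
    and Ide_hom: "X \<in> Obj C \<Longrightarrow> Ide C X \<in> hom C X X"
    and Comp_hom: "f \<in> hom C X Y \<Longrightarrow> g \<in> hom C Y Z \<Longrightarrow> g \<cdot> f \<in> hom C X Z"
    and Comp_Ide: "f \<in> hom C X Y \<Longrightarrow> f \<cdot> Ide C X = f"
    and Ide_Comp: "f \<in> hom C X Y \<Longrightarrow> Ide C Y \<cdot> f = f"
    and Comp_assoc: "f \<in> hom C W X \<Longrightarrow> g \<in> hom C X Y \<Longrightarrow> h \<in> hom C Y Z \<Longrightarrow>
        (h \<cdot> g) \<cdot> f = h \<cdot> (g \<cdot> f)"

record ('o, 'm, 'p, 'n) funct =
  FObj :: "'o \<Rightarrow> 'p"
  FArr :: "'m \<Rightarrow> 'n"

definition is_functor ::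
  "('o, 'm) cat \<Rightarrow> ('p, 'n) cat \<Rightarrow> ('o, 'm, 'p, 'n) funct \<Rightarrow> bool" where
  "is_functor C D U \<longleftrightarrow>
     category C \<and> category D \<and>
     (\<forall>X \<in> Obj C. FObj U X \<in> Obj D \<and> FArr U (Ide C X) = Ide D (FObj U X)) \<and>
     (\<forall>X Y. \<forall>f \<in> hom C X Y. FArr U f \<in> hom D (FObj U X) (FObj U Y)) \<and>
     (\<forall>X Y Z. \<forall>f \<in> hom C X Y. \<forall>g \<in> hom C Y Z.
        FArr U (g \<cdot>\<^bsub>C\<^esub> f) = FArr U g \<cdot>\<^bsub>D\<^esub> FArr U f)"

definition cocartesian ::
  "('o, 'm) cat \<Rightarrow> ('p, 'n) cat \<Rightarrow> ('o, 'm, 'p, 'n) funct \<Rightarrow> 'm \<Rightarrow> bool" where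
  "cocartesian C D U f \<longleftrightarrow>
     f \<in> Arr C \<and>
     (\<forall>\<phi> \<in> Arr C. Dom C \<phi> = Dom C f \<and> FArr U \<phi> = FArr U f \<longrightarrow>
        (\<exists>!\<psi>. \<psi> \<in> hom C (Cod C f) (Cod C \<phi>) \<and> \<psi> \<cdot>\<^bsub>C\<^esub> f = \<phi> \<and>
              FArr U \<psi> = Ide D (FObj U (Cod C f))))"

definition cofibration ::
  "('o, 'm) cat \<Rightarrow> ('p, 'n) cat \<Rightarrow> ('o, 'm, 'p, 'n) funct \<Rightarrow> bool" where
  "cofibration C D U \<longleftrightarrow>
     (\<forall>X \<in> Obj C. \<forall>Y \<in> Obj D. \<forall>g \<in> hom D (FObj U X) Y.
        \<exists>f \<in> Arr C. Dom C f = X \<and> FArr U f = g \<and> cocartesian C D U f)"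


section \<open>Limits and elementary toposes\<close>

definition is_terminal :: "('o, 'm) cat \<Rightarrow> 'o \<Rightarrow> bool" where
  "is_terminal C T \<longleftrightarrow> T \<in> Obj C \<and> (\<forall>X \<in> Obj C. \<exists>!u. u \<in> hom C X T)"

text \<open>The square \<open>f p = g q\<close> is a pullback.\<close>

definition is_pullback :: "('o, 'm) cat \<Rightarrow> 'm \<Rightarrow> 'm \<Rightarrow> 'm \<Rightarrow> 'm \<Rightarrow> bool" where
  "is_pullback C f g p q \<longleftrightarrow>
     {f, g, p, q} \<subseteq> Arr C \<and> Cod C f = Cod C g \<and>
     Dom C p = Dom C q \<and> Cod C p = Dom C f \<and> Cod C q = Dom C g \<and>
     f \<cdot>\<^bsub>C\<^esub> p = g \<cdot>\<^bsub>C\<^esub> q \<and>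
     (\<forall>W \<in> Obj C. \<forall>a \<in> hom C W (Dom C f). \<forall>b \<in> hom C W (Dom C g).
        f \<cdot>\<^bsub>C\<^esub> a = g \<cdot>\<^bsub>C\<^esub> b \<longrightarrow>
        (\<exists>!h. h \<in> hom C W (Dom C p) \<and> p \<cdot>\<^bsub>C\<^esub> h = a \<and> q \<cdot>\<^bsub>C\<^esub> h = b))"

text \<open>All finite limits, in the equivalent form: a terminal object and all pullbacks.\<close>

definition finitely_complete :: "('o, 'm) cat \<Rightarrow> bool" where
  "finitely_complete C \<longleftrightarrow>
     (\<exists>T. is_terminal C T) \<and>
     (\<forall>f \<in> Arr C. \<forall>g \<in> Arr C. Cod C f = Cod C g \<longrightarrow> (\<exists>p q. is_pullback C f g p q))"

definition is_product :: "('o, 'm) cat \<Rightarrow> 'o \<Rightarrow> 'o \<Rightarrow> 'o \<times> 'm \<times> 'm \<Rightarrow> bool" where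
  "is_product C X Y = (\<lambda>(P, p, q).
     P \<in> Obj C \<and> p \<in> hom C P X \<and> q \<in> hom C P Y \<and>
     (\<forall>W \<in> Obj C. \<forall>a \<in> hom C W X. \<forall>b \<in> hom C W Y.
        \<exists>!h. h \<in> hom C W P \<and> p \<cdot>\<^bsub>C\<^esub> h = a \<and> q \<cdot>\<^bsub>C\<^esub> h = b))"

text \<open>
  A choice of binary products, meaningful whenever they exist; nothing below depends, up to
  canonical isomorphism, on which products are chosen.
\<close>

definition prod_cone :: "('o, 'm) cat \<Rightarrow> 'o \<Rightarrow> 'o \<Rightarrow> 'o \<times> 'm \<times> 'm" where
  "prod_cone C X Y = (SOME t. is_product C X Y t)"

definition prod_obj :: "('o, 'm) cat \<Rightarrow> 'o \<Rightarrow> 'o \<Rightarrow> 'o" where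
  "prod_obj C X Y = fst (prod_cone C X Y)"

definition proj1 :: "('o, 'm) cat \<Rightarrow> 'o \<Rightarrow> 'o \<Rightarrow> 'm" where
  "proj1 C X Y = fst (snd (prod_cone C X Y))"

definition proj2 :: "('o, 'm) cat \<Rightarrow> 'o \<Rightarrow> 'o \<Rightarrow> 'm" where
  "proj2 C X Y = snd (snd (prod_cone C X Y))"

definition pairing :: "('o, 'm) cat \<Rightarrow> 'm \<Rightarrow> 'm \<Rightarrow> 'm" where
  "pairing C a b =
     (THE h. h \<in> hom C (Dom C a) (prod_obj C (Cod C a) (Cod C b)) \<and>
             proj1 C (Cod C a) (Cod C b) \<cdot>\<^bsub>C\<^esub> h = a \<and>
             proj2 C (Cod C a) (Cod C b) \<cdot>\<^bsub>C\<^esub> h = b)"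

definition prod_map :: "('o, 'm) cat \<Rightarrow> 'm \<Rightarrow> 'm \<Rightarrow> 'm" where
  "prod_map C f g =
     pairing C (f \<cdot>\<^bsub>C\<^esub> proj1 C (Dom C f) (Dom C g)) (g \<cdot>\<^bsub>C\<^esub> proj2 C (Dom C f) (Dom C g))"

definition is_exponential :: "('o, 'm) cat \<Rightarrow> 'o \<Rightarrow> 'o \<Rightarrow> 'o \<Rightarrow> 'm \<Rightarrow> bool" where
  "is_exponential C A B P ev \<longleftrightarrow>
     P \<in> Obj C \<and> ev \<in> hom C (prod_obj C P A) B \<and>
     (\<forall>Z \<in> Obj C. \<forall>h \<in> hom C (prod_obj C Z A) B.
        \<exists>!k. k \<in> hom C Z P \<and> ev \<cdot>\<^bsub>C\<^esub> prod_map C k (Ide C A) = h)"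

definition is_mono :: "('o, 'm) cat \<Rightarrow> 'm \<Rightarrow> bool" where
  "is_mono C m \<longleftrightarrow>
     m \<in> Arr C \<and>
     (\<forall>W. \<forall>a \<in> hom C W (Dom C m). \<forall>b \<in> hom C W (Dom C m).
        m \<cdot>\<^bsub>C\<^esub> a = m \<cdot>\<^bsub>C\<^esub> b \<longrightarrow> a = b)"

definition is_iso :: "('o, 'm) cat \<Rightarrow> 'm \<Rightarrow> bool" where
  "is_iso C i \<longleftrightarrow>
     i \<in> Arr C \<and>
     (\<exists>j \<in> hom C (Cod C i) (Dom C i).
        j \<cdot>\<^bsub>C\<^esub> i = Ide C (Dom C i) \<and> i \<cdot>\<^bsub>C\<^esub> j = Ide C (Cod C i))"

definition is_subobject_classifier :: "('o, 'm) cat \<Rightarrow> 'm \<Rightarrow> bool" where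
  "is_subobject_classifier C t \<longleftrightarrow>
     t \<in> Arr C \<and> is_terminal C (Dom C t) \<and>
     (\<forall>m. is_mono C m \<longrightarrow>
        (\<exists>!\<chi>. \<chi> \<in> hom C (Cod C m) (Cod C t) \<and> (\<exists>u. is_pullback C \<chi> t m u)))"

definition elementary_topos :: "('o, 'm) cat \<Rightarrow> bool" where
  "elementary_topos C \<longleftrightarrow>
     category C \<and> finitely_complete C \<and>
     (\<forall>A \<in> Obj C. \<forall>B \<in> Obj C. \<exists>P ev. is_exponential C A B P ev) \<and>
     (\<exists>t. is_subobject_classifier C t)"


section \<open>Subobjects\<close>

text \<open>A subobject of \<open>X\<close> is an isomorphism class of monomorphisms into \<open>X\<close>.\<close>

definition monos_into :: "('o, 'm) cat \<Rightarrow> 'o \<Rightarrow> 'm set" where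
  "monos_into C X = {m. is_mono C m \<and> Cod C m = X}"

definition iso_over :: "('o, 'm) cat \<Rightarrow> 'o \<Rightarrow> ('m \<times> 'm) set" where
  "iso_over C X =
     {(m, n). m \<in> monos_into C X \<and> n \<in> monos_into C X \<and>
              (\<exists>i \<in> hom C (Dom C m) (Dom C n). is_iso C i \<and> n \<cdot>\<^bsub>C\<^esub> i = m)}"

definition Sub :: "('o, 'm) cat \<Rightarrow> 'o \<Rightarrow> 'm set set" where
  "Sub C X = monos_into C X // iso_over C X"

definition factors :: "('o, 'm) cat \<Rightarrow> 'm \<Rightarrow> 'm \<Rightarrow> bool" where
  "factors C f m \<longleftrightarrow> (\<exists>h \<in> hom C (Dom C f) (Dom C m). m \<cdot>\<^bsub>C\<^esub> h = f)"

definition sub_le :: "('o, 'm) cat \<Rightarrow> 'm set \<Rightarrow> 'm set \<Rightarrow> bool" where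
  "sub_le C A B \<longleftrightarrow> (\<exists>m \<in> A. \<exists>n \<in> B. factors C m n)"

definition is_chain :: "('o, 'm) cat \<Rightarrow> 'o \<Rightarrow> (nat \<Rightarrow> 'm set) \<Rightarrow> bool" where
  "is_chain C X A \<longleftrightarrow> (\<forall>i. A i \<in> Sub C X) \<and> (\<forall>i. sub_le C (A i) (A (Suc i)))"

definition is_chain_sup :: "('o, 'm) cat \<Rightarrow> 'o \<Rightarrow> (nat \<Rightarrow> 'm set) \<Rightarrow> 'm set \<Rightarrow> bool" where
  "is_chain_sup C X A S \<longleftrightarrow>
     S \<in> Sub C X \<and> (\<forall>i. sub_le C (A i) S) \<and>
     (\<forall>T \<in> Sub C X. (\<forall>i. sub_le C (A i) T) \<longrightarrow> sub_le C S T)"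

definition has_chain_suprema :: "('o, 'm) cat \<Rightarrow> bool" where
  "has_chain_suprema C \<longleftrightarrow>
     (\<forall>X \<in> Obj C. \<forall>A. is_chain C X A \<longrightarrow> (\<exists>S. is_chain_sup C X A S))"

text \<open>
  The monomorphisms arising as pullbacks along \<open>g\<close> of representatives of \<open>A\<close> form a whole
  isomorphism class, so this set is the subobject \<open>g\<inverse>(A)\<close> itself.
\<close>

definition inv_image :: "('o, 'm) cat \<Rightarrow> 'm \<Rightarrow> 'm set \<Rightarrow> 'm set" where
  "inv_image C g A = {m. \<exists>n \<in> A. \<exists>q. is_pullback C g n m q}"

text \<open>\<open>m\<close> is the image of \<open>g\<close>: the smallest monomorphism through which \<open>g\<close> factors.\<close>

definition is_image :: "('o, 'm) cat \<Rightarrow> 'm \<Rightarrow> 'm \<Rightarrow> bool" where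
  "is_image C g m \<longleftrightarrow>
     is_mono C m \<and> Cod C m = Cod C g \<and> factors C g m \<and>
     (\<forall>n. is_mono C n \<and> Cod C n = Cod C g \<and> factors C g n \<longrightarrow> factors C m n)"


section \<open>Internal relations\<close>

definition Rel :: "('o, 'm) cat \<Rightarrow> 'o \<Rightarrow> 'm set set" where
  "Rel C X = Sub C (prod_obj C X X)"

definition diag_rel :: "('o, 'm) cat \<Rightarrow> 'o \<Rightarrow> 'm set" where
  "diag_rel C X =
     iso_over C (prod_obj C X X) `` {pairing C (Ide C X) (Ide C X)}"

text \<open>
  Composing with the twist isomorphism maps the isomorphism class \<open>R\<close> onto an isomorphism class.
\<close>

definition op_rel :: "('o, 'm) cat \<Rightarrow> 'o \<Rightarrow> 'm set \<Rightarrow> 'm set" where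
  "op_rel C X R = (\<lambda>r. pairing C (proj2 C X X) (proj1 C X X) \<cdot>\<^bsub>C\<^esub> r) ` R"

text \<open>
  \<open>R \<circ> S\<close> is the image in \<open>X \<times> X\<close> of the object of triples \<open>(x, y, z)\<close> with \<open>x S y\<close> and
  \<open>y R z\<close>, the latter being the pullback of the second leg of \<open>S\<close> and the first leg of \<open>R\<close>.
  Again all the representatives together form the isomorphism class.
\<close>

definition comp_rel :: "('o, 'm) cat \<Rightarrow> 'o \<Rightarrow> 'm set \<Rightarrow> 'm set \<Rightarrow> 'm set" where
  "comp_rel C X R S =
     {m. \<exists>r \<in> R. \<exists>s \<in> S. \<exists>p q.
        is_pullback C (proj2 C X X \<cdot>\<^bsub>C\<^esub> s) (proj1 C X X \<cdot>\<^bsub>C\<^esub> r) p q \<and>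
        is_image C (pairing C ((proj1 C X X \<cdot>\<^bsub>C\<^esub> s) \<cdot>\<^bsub>C\<^esub> p)
                              ((proj2 C X X \<cdot>\<^bsub>C\<^esub> r) \<cdot>\<^bsub>C\<^esub> q)) m}"

definition reflexive_rel :: "('o, 'm) cat \<Rightarrow> 'o \<Rightarrow> 'm set \<Rightarrow> bool" where
  "reflexive_rel C X R \<longleftrightarrow> sub_le C (diag_rel C X) R"

definition symmetric_rel :: "('o, 'm) cat \<Rightarrow> 'o \<Rightarrow> 'm set \<Rightarrow> bool" where
  "symmetric_rel C X R \<longleftrightarrow> sub_le C (op_rel C X R) R"

definition transitive_rel :: "('o, 'm) cat \<Rightarrow> 'o \<Rightarrow> 'm set \<Rightarrow> bool" where
  "transitive_rel C X R \<longleftrightarrow> sub_le C (comp_rel C X R R) R"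

definition preorder_rel :: "('o, 'm) cat \<Rightarrow> 'o \<Rightarrow> 'm set \<Rightarrow> bool" where
  "preorder_rel C X R \<longleftrightarrow> R \<in> Rel C X \<and> reflexive_rel C X R \<and> transitive_rel C X R"

definition equivalence_rel :: "('o, 'm) cat \<Rightarrow> 'o \<Rightarrow> 'm set \<Rightarrow> bool" where
  "equivalence_rel C X R \<longleftrightarrow> preorder_rel C X R \<and> symmetric_rel C X R"

text \<open>The relation \<open>f\<inverse>(S)\<close> for a relation \<open>S\<close> on the codomain of \<open>f\<close>.\<close>

definition inv_rel :: "('o, 'm) cat \<Rightarrow> 'm \<Rightarrow> 'm set \<Rightarrow> 'm set" where
  "inv_rel C f S = inv_image C (prod_map C f f) S"


section \<open>The categories of preorders and of equivalence relations\<close>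

text \<open>
  The category of pairs \<open>(X, R)\<close> satisfying \<open>P\<close>.  An arrow records its source and target, which
  its underlying map does not determine.
\<close>

definition rel_cat ::
  "('o \<Rightarrow> 'm set \<Rightarrow> bool) \<Rightarrow> ('o, 'm) cat \<Rightarrow>
   ('o \<times> 'm set, ('o \<times> 'm set) \<times> 'm \<times> ('o \<times> 'm set)) cat" where
  "rel_cat P C =
     \<lparr>Obj = {(X, R). X \<in> Obj C \<and> P X R},
      Arr = {((X, R), f, (Y, S)) | X R f Y S.
               X \<in> Obj C \<and> P X R \<and> Y \<in> Obj C \<and> P Y S \<and>
               f \<in> hom C X Y \<and> sub_le C R (inv_rel C f S)},
      Dom = (\<lambda>(A, f, B). A),
      Cod = (\<lambda>(A, f, B). B),
      Ide = (\<lambda>(X, R). ((X, R), Ide C X, (X, R))),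
      Comp = (\<lambda>(_, g, D) (A, f, _). (A, g \<cdot>\<^bsub>C\<^esub> f, D))\<rparr>"

definition PrO ::
  "('o, 'm) cat \<Rightarrow> ('o \<times> 'm set, ('o \<times> 'm set) \<times> 'm \<times> ('o \<times> 'm set)) cat" where
  "PrO C = rel_cat (preorder_rel C) C"

definition Equ ::
  "('o, 'm) cat \<Rightarrow> ('o \<times> 'm set, ('o \<times> 'm set) \<times> 'm \<times> ('o \<times> 'm set)) cat" where
  "Equ C = rel_cat (equivalence_rel C) C"

definition ground ::
  "('o \<times> 'm set, ('o \<times> 'm set) \<times> 'm \<times> ('o \<times> 'm set), 'o, 'm) funct" where
  "ground = \<lparr>FObj = fst, FArr = (\<lambda>(_, f, _). f)\<rparr>"

section \<open>The ground functor is a functor\<close>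

context category
begin

lemma hom_Obj:
  assumes "f \<in> hom C X Y"
  shows "X \<in> Obj C \<and> Y \<in> Obj C"
proof -
  have "f \<in> Arr C" "Dom C f = X" "Cod C f = Y" using assms by (simp_all add: hom_def)
  then show ?thesis using Dom_Obj[of f] Cod_Obj[of f] by simp
qed

lemma factors_refl:
  assumes "f \<in> Arr C"
  shows "factors C f f"
proof -
  have "f \<in> hom C (Dom C f) (Cod C f)" using assms by (simp add: hom_def)
  then show ?thesis using Ide_hom[OF Dom_Obj[OF assms]] Comp_Ide unfolding factors_def by blast
qed

lemma factors_trans:
  assumes "factors C f m" "factors C m n" "n \<in> Arr C" "Cod C n = Y"
  shows "factors C f n"
proof -
  obtain h where h: "h \<in> hom C (Dom C f) (Dom C m)" "m \<cdot> h = f"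
    using assms(1) by (auto simp: factors_def)
  obtain k where k: "k \<in> hom C (Dom C m) (Dom C n)" "n \<cdot> k = m"
    using assms(2) by (auto simp: factors_def)
  have n: "n \<in> hom C (Dom C n) Y" using assms(3,4) by (simp add: hom_def)
  have "n \<cdot> (k \<cdot> h) = f"
    using Comp_assoc[OF h(1) k(1) n] h(2) k(2) by simp
  with Comp_hom[OF h(1) k(1)] show ?thesis by (auto simp: factors_def)
qed

lemma factors_comp:
  assumes "factors C f m" "m \<in> hom C A X" "g \<in> hom C X Y"
  shows "factors C (g \<cdot> f) (g \<cdot> m)"
proof -
  obtain h where h: "h \<in> hom C (Dom C f) (Dom C m)" "m \<cdot> h = f"
    using assms(1) by (auto simp: factors_def)
  have A: "Dom C m = A" using assms(2) by (simp add: hom_def)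
  have gm: "g \<cdot> m \<in> hom C A Y" using Comp_hom[OF assms(2,3)] .
  have f: "f \<in> hom C (Dom C f) X" using Comp_hom[OF h(1)[unfolded A] assms(2)] h(2) by simp
  have gf: "g \<cdot> f \<in> hom C (Dom C f) Y" using Comp_hom[OF f assms(3)] .
  have "(g \<cdot> m) \<cdot> h = g \<cdot> f"
    using Comp_assoc[OF h(1)[unfolded A] assms(2,3)] h(2) by simp
  moreover have "h \<in> hom C (Dom C (g \<cdot> f)) (Dom C (g \<cdot> m))"
    using h(1) gf gm A by (simp add: hom_def)
  ultimately show ?thesis by (auto simp: factors_def)
qed

lemma iso_over_factors:
  assumes "(m, n) \<in> iso_over C X"
  shows "factors C m n" "factors C n m"
proof -
  obtain i j where i: "i \<in> hom C (Dom C m) (Dom C n)" "n \<cdot> i = m"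
    and j: "j \<in> hom C (Cod C i) (Dom C i)" "i \<cdot> j = Ide C (Cod C i)"
    using assms by (auto simp: iso_over_def is_iso_def)
  have n: "n \<in> hom C (Dom C n) X"
    using assms by (auto simp: iso_over_def monos_into_def is_mono_def hom_def)
  have j': "j \<in> hom C (Dom C n) (Dom C m)" "i \<cdot> j = Ide C (Dom C n)"
    using j i by (auto simp: hom_def)
  show "factors C m n" using i by (auto simp: factors_def)
  have "m \<cdot> j = n" using Comp_assoc[OF j'(1) i(1) n] i(2) j'(2) Comp_Ide[OF n] by simp
  with j'(1) show "factors C n m" by (auto simp: factors_def)
qed

lemma mutual_factors_iso_over:
  assumes m: "m \<in> monos_into C X" and n: "n \<in> monos_into C X"
    and "factors C m n" "factors C n m"
  shows "(m, n) \<in> iso_over C X"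
proof -
  obtain i where i: "i \<in> hom C (Dom C m) (Dom C n)" "n \<cdot> i = m"
    using assms(3) by (auto simp: factors_def)
  obtain j where j: "j \<in> hom C (Dom C n) (Dom C m)" "m \<cdot> j = n"
    using assms(4) by (auto simp: factors_def)
  have mm: "m \<in> hom C (Dom C m) X" "is_mono C m"
    using m by (auto simp: monos_into_def is_mono_def hom_def)
  have nn: "n \<in> hom C (Dom C n) X" "is_mono C n"
    using n by (auto simp: monos_into_def is_mono_def hom_def)
  have "m \<cdot> (j \<cdot> i) = m \<cdot> Ide C (Dom C m)"
    using Comp_assoc[OF i(1) j(1) mm(1)] i(2) j(2) Comp_Ide[OF mm(1)] by simp
  then have ji: "j \<cdot> i = Ide C (Dom C m)"
    using mm(2) Comp_hom[OF i(1) j(1)] Ide_hom hom_Obj[OF mm(1)] by (auto simp: is_mono_def)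
  have "n \<cdot> (i \<cdot> j) = n \<cdot> Ide C (Dom C n)"
    using Comp_assoc[OF j(1) i(1) nn(1)] i(2) j(2) Comp_Ide[OF nn(1)] by simp
  then have ij: "i \<cdot> j = Ide C (Dom C n)"
    using nn(2) Comp_hom[OF j(1) i(1)] Ide_hom hom_Obj[OF nn(1)] by (auto simp: is_mono_def)
  have "is_iso C i" using i(1) j(1) ij ji by (auto simp: is_iso_def hom_def)
  with i m n show ?thesis by (auto simp: iso_over_def)
qed

lemma iso_over_iff:
  "(m, n) \<in> iso_over C X \<longleftrightarrow>
     m \<in> monos_into C X \<and> n \<in> monos_into C X \<and> factors C m n \<and> factors C n m"
proof
  assume *: "(m, n) \<in> iso_over C X"
  then have "m \<in> monos_into C X \<and> n \<in> monos_into C X" by (simp add: iso_over_def)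
  with iso_over_factors[OF *] show "m \<in> monos_into C X \<and> n \<in> monos_into C X \<and>
    factors C m n \<and> factors C n m" by simp
qed (use mutual_factors_iso_over in blast)

lemma equiv_iso_over: "equiv (monos_into C X) (iso_over C X)"
proof (rule equivI)
  show "iso_over C X \<subseteq> monos_into C X \<times> monos_into C X" by (auto simp: iso_over_def)
  show "refl_on (monos_into C X) (iso_over C X)"
    by (auto simp: refl_on_def iso_over_iff monos_into_def is_mono_def factors_refl)
  show "sym (iso_over C X)" by (auto simp: sym_def iso_over_iff)
  show "trans (iso_over C X)"
  proof (rule transI)
    fix l m n assume "(l, m) \<in> iso_over C X" "(m, n) \<in> iso_over C X"
    then show "(l, n) \<in> iso_over C X"
      using factors_trans[of l m n X] factors_trans[of n m l X]
      by (simp add: iso_over_iff monos_into_def is_mono_def)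
  qed
qed

lemma Sub_mono:
  assumes "A \<in> Sub C X" "m \<in> A"
  shows "is_mono C m \<and> Cod C m = X"
proof -
  have "A \<subseteq> monos_into C X"
    using in_quotient_imp_subset[OF equiv_iso_over assms(1)[unfolded Sub_def]] .
  with assms(2) show ?thesis by (auto simp: monos_into_def)
qed

lemma Sub_ex:
  assumes "A \<in> Sub C X"
  shows "\<exists>m. m \<in> A"
proof -
  have "A \<noteq> {}" using in_quotient_imp_non_empty[OF equiv_iso_over assms[unfolded Sub_def]] .
  then show ?thesis by blast
qed

lemma Sub_factors:
  assumes "A \<in> Sub C X" "m \<in> A" "n \<in> A"
  shows "factors C m n"
proof -
  have "(m, n) \<in> iso_over C X"
  proof (rule in_quotient_imp_in_rel[OF equiv_iso_over assms(1)[unfolded Sub_def]])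
    show "{m, n} \<subseteq> A" using assms(2,3) by blast
  qed
  then show ?thesis by (rule iso_over_factors)
qed

lemma sub_le_iff:
  assumes "A \<in> Sub C X" "B \<in> Sub C X" "m \<in> A" "n \<in> B"
  shows "sub_le C A B \<longleftrightarrow> factors C m n"
proof
  assume "sub_le C A B"
  then obtain m' n' where *: "m' \<in> A" "n' \<in> B" "factors C m' n'" by (auto simp: sub_le_def)
  have "factors C m m'" "factors C n' n" using Sub_factors assms * by blast+
  moreover have "n' \<in> Arr C" "n \<in> Arr C" using Sub_mono assms * by (auto simp: is_mono_def)
  ultimately show "factors C m n" using *(3) factors_trans by blast
qed (use assms in \<open>auto simp: sub_le_def\<close>)

end

locale finitely_complete_category = category +
  assumes finitely_complete: "finitely_complete C"
begin

lemma pullback_exists: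
  assumes "f \<in> hom C X Z" "g \<in> hom C Y Z"
  shows "\<exists>p q. is_pullback C f g p q"
proof -
  have "f \<in> Arr C" "g \<in> Arr C" "Cod C f = Cod C g" using assms by (auto simp: hom_def)
  then show ?thesis using finitely_complete unfolding finitely_complete_def by blast
qed

lemma pullback_univ:
  assumes pq: "is_pullback C f g p q" and f: "f \<in> hom C X Z" and g: "g \<in> hom C Y Z"
    and a: "a \<in> hom C W X" and b: "b \<in> hom C W Y" and eq: "f \<cdot> a = g \<cdot> b"
  shows "\<exists>!h. h \<in> hom C W (Dom C p) \<and> p \<cdot> h = a \<and> q \<cdot> h = b"
proof -
  have D: "Dom C f = X" "Dom C g = Y" and W: "W \<in> Obj C"
    using f g hom_Obj[OF a] by (simp_all add: hom_def)
  have "\<forall>W \<in> Obj C. \<forall>a \<in> hom C W X. \<forall>b \<in> hom C W Y. f \<cdot> a = g \<cdot> b \<longrightarrow>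
      (\<exists>!h. h \<in> hom C W (Dom C p) \<and> p \<cdot> h = a \<and> q \<cdot> h = b)"
    using pq unfolding is_pullback_def D by (elim conjE)
  from this[rule_format, OF W a b eq] show ?thesis .
qed

lemma product_exists:
  assumes X: "X \<in> Obj C" and Y: "Y \<in> Obj C"
  shows "\<exists>t. is_product C X Y t"
proof -
  obtain T where T: "is_terminal C T" using finitely_complete by (auto simp: finitely_complete_def)
  obtain u where u: "u \<in> hom C X T" using T X unfolding is_terminal_def by blast
  obtain v where v: "v \<in> hom C Y T" using T Y unfolding is_terminal_def by blast
  obtain p q where pq: "is_pullback C u v p q"
    using pullback_exists[OF u v] by blast
  have pq': "p \<in> hom C (Dom C p) X" "q \<in> hom C (Dom C p) Y"
    using pq u v by (auto simp: is_pullback_def hom_def)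
  have "is_product C X Y (Dom C p, p, q)"
    unfolding is_product_def split
  proof (intro conjI ballI)
    show "Dom C p \<in> Obj C" using hom_Obj[OF pq'(1)] by simp
    fix W a b assume W: "W \<in> Obj C" and a: "a \<in> hom C W X" and b: "b \<in> hom C W Y"
    have "u \<cdot> a = v \<cdot> b"
      using T W Comp_hom[OF a u] Comp_hom[OF b v] unfolding is_terminal_def by blast
    then show "\<exists>!h. h \<in> hom C W (Dom C p) \<and> p \<cdot> h = a \<and> q \<cdot> h = b"
      using pullback_univ[OF pq u v a b] by simp
  qed (fact pq')+
  then show ?thesis by blast
qed

lemma product_chosen:
  assumes "X \<in> Obj C" "Y \<in> Obj C"
  shows "is_product C X Y (prod_obj C X Y, proj1 C X Y, proj2 C X Y)"
proof -
  have "is_product C X Y (prod_cone C X Y)"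
    unfolding prod_cone_def by (rule someI_ex[OF product_exists[OF assms]])
  then show ?thesis by (simp add: prod_obj_def proj1_def proj2_def)
qed

lemma proj_hom:
  assumes "X \<in> Obj C" "Y \<in> Obj C"
  shows "proj1 C X Y \<in> hom C (prod_obj C X Y) X" "proj2 C X Y \<in> hom C (prod_obj C X Y) Y"
    "prod_obj C X Y \<in> Obj C"
  using product_chosen[OF assms] by (simp_all add: is_product_def)

lemma pairing:
  assumes a: "a \<in> hom C W X" and b: "b \<in> hom C W Y"
  shows "pairing C a b \<in> hom C W (prod_obj C X Y)"
    "proj1 C X Y \<cdot> pairing C a b = a" "proj2 C X Y \<cdot> pairing C a b = b"
proof -
  have D: "Dom C a = W" "Cod C a = X" "Cod C b = Y" using a b by (auto simp: hom_def)
  have "\<exists>!h. h \<in> hom C W (prod_obj C X Y) \<and> proj1 C X Y \<cdot> h = a \<and> proj2 C X Y \<cdot> h = b"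
    using product_chosen[of X Y] hom_Obj[OF a] hom_Obj[OF b] a b by (simp add: is_product_def)
  from theI'[OF this]
  show "pairing C a b \<in> hom C W (prod_obj C X Y)"
    "proj1 C X Y \<cdot> pairing C a b = a" "proj2 C X Y \<cdot> pairing C a b = b"
    by (simp_all add: pairing_def D)
qed

lemma product_ext:
  assumes X: "X \<in> Obj C" and Y: "Y \<in> Obj C"
    and h: "h \<in> hom C W (prod_obj C X Y)" and k: "k \<in> hom C W (prod_obj C X Y)"
    and 1: "proj1 C X Y \<cdot> h = proj1 C X Y \<cdot> k" and 2: "proj2 C X Y \<cdot> h = proj2 C X Y \<cdot> k"
  shows "h = k"
proof -
  have "\<exists>!l. l \<in> hom C W (prod_obj C X Y) \<and> proj1 C X Y \<cdot> l = proj1 C X Y \<cdot> h \<and>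
             proj2 C X Y \<cdot> l = proj2 C X Y \<cdot> h"
    using product_chosen[OF X Y] hom_Obj[OF h] Comp_hom[OF h proj_hom(1)[OF X Y]]
      Comp_hom[OF h proj_hom(2)[OF X Y]] by (simp add: is_product_def)
  then show ?thesis using h k 1 2 by metis
qed

lemma prod_map:
  assumes f: "f \<in> hom C X X'" and g: "g \<in> hom C Y Y'"
  shows "prod_map C f g \<in> hom C (prod_obj C X Y) (prod_obj C X' Y')"
    "proj1 C X' Y' \<cdot> prod_map C f g = f \<cdot> proj1 C X Y"
    "proj2 C X' Y' \<cdot> prod_map C f g = g \<cdot> proj2 C X Y"
proof -
  have D: "Dom C f = X" "Dom C g = Y" using f g by (auto simp: hom_def)
  have O: "X \<in> Obj C" "Y \<in> Obj C" using hom_Obj f g by auto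
  note P = pairing[OF Comp_hom[OF proj_hom(1)[OF O] f] Comp_hom[OF proj_hom(2)[OF O] g]]
  show "prod_map C f g \<in> hom C (prod_obj C X Y) (prod_obj C X' Y')"
    "proj1 C X' Y' \<cdot> prod_map C f g = f \<cdot> proj1 C X Y"
    "proj2 C X' Y' \<cdot> prod_map C f g = g \<cdot> proj2 C X Y"
    using P by (simp_all add: prod_map_def D)
qed

lemma prod_map_Ide:
  assumes "X \<in> Obj C" "Y \<in> Obj C"
  shows "prod_map C (Ide C X) (Ide C Y) = Ide C (prod_obj C X Y)"
proof (rule product_ext[OF assms])
  note P = prod_map[OF Ide_hom[OF assms(1)] Ide_hom[OF assms(2)]]
  note Q = proj_hom[OF assms]
  show "prod_map C (Ide C X) (Ide C Y) \<in> hom C (prod_obj C X Y) (prod_obj C X Y)" by (fact P)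
  show "Ide C (prod_obj C X Y) \<in> hom C (prod_obj C X Y) (prod_obj C X Y)"
    using Ide_hom Q(3) .
  show "proj1 C X Y \<cdot> prod_map C (Ide C X) (Ide C Y) = proj1 C X Y \<cdot> Ide C (prod_obj C X Y)"
    using P(2) Ide_Comp[OF Q(1)] Comp_Ide[OF Q(1)] by simp
  show "proj2 C X Y \<cdot> prod_map C (Ide C X) (Ide C Y) = proj2 C X Y \<cdot> Ide C (prod_obj C X Y)"
    using P(3) Ide_Comp[OF Q(2)] Comp_Ide[OF Q(2)] by simp
qed

lemma prod_map_Comp:
  assumes f: "f \<in> hom C X X'" and g: "g \<in> hom C Y Y'"
    and f': "f' \<in> hom C X' X''" and g': "g' \<in> hom C Y' Y''"
  shows "prod_map C (f' \<cdot> f) (g' \<cdot> g) = prod_map C f' g' \<cdot> prod_map C f g"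
proof -
  note P = prod_map[OF f g] and P' = prod_map[OF f' g']
  note P'' = prod_map[OF Comp_hom[OF f f'] Comp_hom[OF g g']]
  have O: "X \<in> Obj C" "Y \<in> Obj C" "X' \<in> Obj C" "Y' \<in> Obj C" "X'' \<in> Obj C" "Y'' \<in> Obj C"
    using hom_Obj f g f' g' by auto
  note Q = proj_hom[OF O(1,2)] and Q' = proj_hom[OF O(3,4)] and Q'' = proj_hom[OF O(5,6)]
  show ?thesis
  proof (rule product_ext[OF O(5,6) P''(1) Comp_hom[OF P(1) P'(1)]])
    show "proj1 C X'' Y'' \<cdot> prod_map C (f' \<cdot> f) (g' \<cdot> g) =
          proj1 C X'' Y'' \<cdot> prod_map C f' g' \<cdot> prod_map C f g"
      using Comp_assoc[OF P(1) P'(1) Q''(1)] Comp_assoc[OF P(1) Q'(1) f'] Comp_assoc[OF Q(1) f f']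
        P(2) P'(2) P''(2) by simp
    show "proj2 C X'' Y'' \<cdot> prod_map C (f' \<cdot> f) (g' \<cdot> g) =
          proj2 C X'' Y'' \<cdot> prod_map C f' g' \<cdot> prod_map C f g"
      using Comp_assoc[OF P(1) P'(1) Q''(2)] Comp_assoc[OF P(1) Q'(2) g'] Comp_assoc[OF Q(2) g g']
        P(3) P'(3) P''(3) by simp
  qed
qed

lemma sub_le_inv_image_iff:
  assumes A: "A \<in> Sub C X" and B: "B \<in> Sub C Y" and g: "g \<in> hom C X Y"
    and m: "m \<in> A" and n: "n \<in> B"
  shows "sub_le C A (inv_image C g B) \<longleftrightarrow> factors C (g \<cdot> m) n"
proof
  have m': "m \<in> hom C (Dom C m) X" using Sub_mono[OF A m] by (auto simp: is_mono_def hom_def)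
  have n': "n \<in> hom C (Dom C n) Y" using Sub_mono[OF B n] by (auto simp: is_mono_def hom_def)
  have gm: "g \<cdot> m \<in> hom C (Dom C m) Y" using Comp_hom[OF m' g] .
  {
    assume "sub_le C A (inv_image C g B)"
    then obtain m1 n1 p q where *: "m1 \<in> A" "n1 \<in> B" "is_pullback C g n1 p q" "factors C m1 p"
      by (auto simp: sub_le_def inv_image_def)
    have p: "p \<in> hom C (Dom C p) X" "Dom C q = Dom C p" "g \<cdot> p = n1 \<cdot> q"
      "q \<in> hom C (Dom C p) (Dom C n1)"
      using *(3) g by (auto simp: is_pullback_def hom_def)
    have "factors C m m1" using Sub_factors[OF A m *(1)] .
    then have "factors C m p" using factors_trans[OF _ *(4)] p by (auto simp: hom_def)
    then have 1: "factors C (g \<cdot> m) (g \<cdot> p)" using factors_comp[OF _ p(1) g] by blast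
    have gp: "g \<cdot> p \<in> hom C (Dom C p) Y" using Comp_hom[OF p(1) g] .
    have 2: "factors C (g \<cdot> p) n1" using p gp by (auto simp: factors_def hom_def)
    have n1: "n1 \<in> Arr C" using Sub_mono[OF B *(2)] by (auto simp: is_mono_def)
    have "factors C (g \<cdot> m) n1" using factors_trans[OF 1 2 n1] by blast
    moreover have "factors C n1 n" using Sub_factors[OF B *(2) n] .
    ultimately show "factors C (g \<cdot> m) n" using factors_trans n' by (auto simp: hom_def)
  next
    assume "factors C (g \<cdot> m) n"
    then obtain h where h: "h \<in> hom C (Dom C m) (Dom C n)" "n \<cdot> h = g \<cdot> m"
      using gm by (auto simp: factors_def hom_def)
    obtain p q where pq: "is_pullback C g n p q"
      using pullback_exists[OF g n'] by blast
    have "g \<cdot> m = n \<cdot> h" using h(2) by simp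
    then have "\<exists>k. k \<in> hom C (Dom C m) (Dom C p) \<and> p \<cdot> k = m"
      using pullback_univ[OF pq g n' m' h(1)] by blast
    then have "factors C m p" by (auto simp: factors_def)
    with pq n m show "sub_le C A (inv_image C g B)" by (auto simp: sub_le_def inv_image_def)
  }
qed

lemma sub_le_inv_rel_iff:
  assumes R: "R \<in> Rel C X" and S: "S \<in> Rel C Y" and f: "f \<in> hom C X Y"
    and r: "r \<in> R" and s: "s \<in> S"
  shows "sub_le C R (inv_rel C f S) \<longleftrightarrow> factors C (prod_map C f f \<cdot> r) s"
  using sub_le_inv_image_iff[OF R[unfolded Rel_def] S[unfolded Rel_def] prod_map(1)[OF f f] r s]
  by (simp add: inv_rel_def)

lemma inv_rel_Ide:
  assumes "R \<in> Rel C X" "X \<in> Obj C"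
  shows "sub_le C R (inv_rel C (Ide C X) R)"
proof -
  obtain r where r: "r \<in> R" using Sub_ex[OF assms(1)[unfolded Rel_def]] by blast
  have "r \<in> hom C (Dom C r) (prod_obj C X X)"
    using Sub_mono[OF assms(1)[unfolded Rel_def] r] by (auto simp: is_mono_def hom_def)
  then show ?thesis
    using sub_le_inv_rel_iff[OF assms(1,1) Ide_hom[OF assms(2)] r r]
      prod_map_Ide[OF assms(2,2)] Ide_Comp[of r] factors_refl[of r] by (simp add: hom_def)
qed

lemma inv_rel_Comp:
  assumes R: "R \<in> Rel C X" and S: "S \<in> Rel C Y" and T: "T \<in> Rel C Z"
    and f: "f \<in> hom C X Y" and g: "g \<in> hom C Y Z"
    and "sub_le C R (inv_rel C f S)" "sub_le C S (inv_rel C g T)"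
  shows "sub_le C R (inv_rel C (g \<cdot> f) T)"
proof -
  obtain r s t where rst: "r \<in> R" "s \<in> S" "t \<in> T"
    using Sub_ex[OF R[unfolded Rel_def]] Sub_ex[OF S[unfolded Rel_def]]
      Sub_ex[OF T[unfolded Rel_def]] by blast
  have r': "r \<in> hom C (Dom C r) (prod_obj C X X)"
    using Sub_mono[OF R[unfolded Rel_def] rst(1)] by (auto simp: is_mono_def hom_def)
  have s': "s \<in> hom C (Dom C s) (prod_obj C Y Y)"
    using Sub_mono[OF S[unfolded Rel_def] rst(2)] by (auto simp: is_mono_def hom_def)
  have t': "t \<in> Arr C" using Sub_mono[OF T[unfolded Rel_def] rst(3)] by (auto simp: is_mono_def)
  have 1: "factors C (prod_map C f f \<cdot> r) s"
    using assms(6) sub_le_inv_rel_iff[OF R S f rst(1,2)] by simp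
  have 2: "factors C (prod_map C g g \<cdot> s) t"
    using assms(7) sub_le_inv_rel_iff[OF S T g rst(2,3)] by simp
  have "factors C (prod_map C g g \<cdot> prod_map C f f \<cdot> r) (prod_map C g g \<cdot> s)"
    using factors_comp[OF 1 s' prod_map(1)[OF g g]] .
  then have "factors C (prod_map C g g \<cdot> prod_map C f f \<cdot> r) t"
    using factors_trans[OF _ 2 t'] by blast
  then have "factors C (prod_map C (g \<cdot> f) (g \<cdot> f) \<cdot> r) t"
    unfolding prod_map_Comp[OF f f g g]
      Comp_assoc[OF r' prod_map(1)[OF f f] prod_map(1)[OF g g]] .
  then show ?thesis using sub_le_inv_rel_iff[OF R T Comp_hom[OF f g] rst(1,3)] by simp
qed

lemma rel_cat_hom_iff:
  "\<phi> \<in> hom (rel_cat P C) (X, R) (Y, S) \<longleftrightarrow>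
     (\<exists>f. \<phi> = ((X, R), f, (Y, S)) \<and> X \<in> Obj C \<and> P X R \<and> Y \<in> Obj C \<and> P Y S \<and>
          f \<in> hom C X Y \<and> sub_le C R (inv_rel C f S))"
  by (auto simp: hom_def rel_cat_def)

lemma rel_cat_simps:
  "(X, R) \<in> Obj (rel_cat P C) \<longleftrightarrow> X \<in> Obj C \<and> P X R"
  "Ide (rel_cat P C) (X, R) = ((X, R), Ide C X, (X, R))"
  "(B, g, D) \<cdot>\<^bsub>rel_cat P C\<^esub> (A, f, B') = (A, g \<cdot> f, D)"
  by (simp_all add: rel_cat_def)

lemma category_rel_cat:
  assumes P: "\<And>X R. P X R \<Longrightarrow> R \<in> Rel C X"
  shows "category (rel_cat P C)"
proof -
  let ?K = "rel_cat P C"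
  show ?thesis
  proof
    fix \<phi> assume "\<phi> \<in> Arr ?K"
    then show "Dom ?K \<phi> \<in> Obj ?K" "Cod ?K \<phi> \<in> Obj ?K" by (auto simp: rel_cat_def)
  next
    fix A assume "A \<in> Obj ?K"
    then show "Ide ?K A \<in> hom ?K A A"
      using Ide_hom inv_rel_Ide P by (cases A) (auto simp: rel_cat_hom_iff rel_cat_simps)
  next
    fix \<phi> \<psi> A B D assume *: "\<phi> \<in> hom ?K A B" "\<psi> \<in> hom ?K B D"
    obtain X R Y S Z T where [simp]: "A = (X, R)" "B = (Y, S)" "D = (Z, T)"
      by (cases A; cases B; cases D) blast
    obtain f where f: "\<phi> = ((X, R), f, (Y, S))" "X \<in> Obj C" "P X R" "f \<in> hom C X Y"
      "sub_le C R (inv_rel C f S)"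
      using *(1) by (auto simp: rel_cat_hom_iff)
    obtain g where g: "\<psi> = ((Y, S), g, (Z, T))" "P Y S" "Z \<in> Obj C" "P Z T" "g \<in> hom C Y Z"
      "sub_le C S (inv_rel C g T)"
      using *(2) by (auto simp: rel_cat_hom_iff)
    have "sub_le C R (inv_rel C (g \<cdot> f) T)"
      using inv_rel_Comp[OF P[OF f(3)] P[OF g(2)] P[OF g(4)] f(4) g(5) f(5) g(6)] .
    with Comp_hom[OF f(4) g(5)] f(1-3) g(1,3,4) show "\<psi> \<cdot>\<^bsub>?K\<^esub> \<phi> \<in> hom ?K A D"
      by (simp add: rel_cat_hom_iff rel_cat_simps)
  next
    fix \<phi> A B assume *: "\<phi> \<in> hom ?K A B"
    obtain X R Y S where [simp]: "A = (X, R)" "B = (Y, S)" by (cases A; cases B) blast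
    obtain f where f: "\<phi> = ((X, R), f, (Y, S))" "f \<in> hom C X Y"
      using * by (auto simp: rel_cat_hom_iff)
    show "\<phi> \<cdot>\<^bsub>?K\<^esub> Ide ?K A = \<phi>" "Ide ?K B \<cdot>\<^bsub>?K\<^esub> \<phi> = \<phi>"
      using f(1) Comp_Ide[OF f(2)] Ide_Comp[OF f(2)] by (simp_all add: rel_cat_simps)
  next
    fix \<phi> \<psi> \<xi> A B D F
    assume *: "\<phi> \<in> hom ?K A B" "\<psi> \<in> hom ?K B D" "\<xi> \<in> hom ?K D F"
    obtain X R Y S Z T W V where [simp]: "A = (X, R)" "B = (Y, S)" "D = (Z, T)" "F = (W, V)"
      by (cases A; cases B; cases D; cases F) blast
    obtain f where f: "\<phi> = ((X, R), f, (Y, S))" "f \<in> hom C X Y"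
      using *(1) by (auto simp: rel_cat_hom_iff)
    obtain g where g: "\<psi> = ((Y, S), g, (Z, T))" "g \<in> hom C Y Z"
      using *(2) by (auto simp: rel_cat_hom_iff)
    obtain h where h: "\<xi> = ((Z, T), h, (W, V))" "h \<in> hom C Z W"
      using *(3) by (auto simp: rel_cat_hom_iff)
    show "(\<xi> \<cdot>\<^bsub>?K\<^esub> \<psi>) \<cdot>\<^bsub>?K\<^esub> \<phi> = \<xi> \<cdot>\<^bsub>?K\<^esub> (\<psi> \<cdot>\<^bsub>?K\<^esub> \<phi>)"
      using Comp_assoc[OF f(2) g(2) h(2)] by (simp add: f(1) g(1) h(1) rel_cat_simps)
  qed
qed

lemma is_functor_ground:
  assumes "\<And>X R. P X R \<Longrightarrow> R \<in> Rel C X"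
  shows "is_functor (rel_cat P C) C ground"
  unfolding is_functor_def
proof (intro conjI ballI allI)
  show "category (rel_cat P C)" using category_rel_cat[of P, OF assms] .
  show "category C" by (rule category_axioms)
next
  fix A assume "A \<in> Obj (rel_cat P C)"
  then show "FObj ground A \<in> Obj C" "FArr ground (Ide (rel_cat P C) A) = Ide C (FObj ground A)"
    by (cases A; simp add: rel_cat_simps ground_def)+
next
  fix A B \<phi> assume "\<phi> \<in> hom (rel_cat P C) A B"
  then show "FArr ground \<phi> \<in> hom C (FObj ground A) (FObj ground B)"
    by (cases A; cases B) (auto simp: rel_cat_hom_iff ground_def)
next
  fix A B D :: "'a \<times> 'b set" and \<phi> \<psi> :: "('a \<times> 'b set) \<times> 'b \<times> ('a \<times> 'b set)"
  show "FArr ground (\<psi> \<cdot>\<^bsub>rel_cat P C\<^esub> \<phi>) = FArr ground \<psi> \<cdot> FArr ground \<phi>"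
    by (cases \<phi>; cases \<psi>) (simp add: rel_cat_simps ground_def)
qed

end

lemma is_functor_ground_PrO_Equ:
  assumes "elementary_topos C"
  shows "is_functor (PrO C) C ground" "is_functor (Equ C) C ground"
proof -
  interpret finitely_complete_category C
    using assms
    by (simp add: elementary_topos_def finitely_complete_category_def
        finitely_complete_category_axioms_def)
  show "is_functor (PrO C) C ground" "is_functor (Equ C) C ground"
    unfolding PrO_def Equ_def
    by (rule is_functor_ground, simp add: preorder_rel_def equivalence_rel_def)+
qed

end

theory Submission
  imports Defs
begin

text \<open>
  Let \<open>R\<close> be a preorder on \<open>X\<close> and \<open>g : X \<rightarrow> Y\<close>.  A cocartesian arrow above \<open>g\<close> with domain
  \<open>(X, R)\<close> is the same thing as a least preorder \<open>S\<close> on \<open>Y\<close> with \<open>R \<subseteq> g\<inverse>(S)\<close>: the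
  factorization through it has to lie above the identity of \<open>Y\<close>, so it exists exactly when one
  relation contains the other, and it is then unique.  The same holds for equivalence relations.

  The least such \<open>S\<close> can be formed as an intersection.  Containing a given subobject, being
  reflexive, transitive and symmetric are all closure conditions on a subobject of \<open>Z = Y \<times> Y\<close>
  given by Horn rules: if \<open>p\<^sub>1 t, \<dots>, p\<^sub>n t\<close> belong to the subobject, so does \<open>c t\<close>, for all
  generalized elements \<open>t\<close> of an object \<open>T\<close> and fixed arrows \<open>p\<^sub>1, \<dots>, p\<^sub>n, c : T \<rightarrow> Z\<close>.  For
  finitely many rules the closed subobjects of \<open>Z\<close> are carved out of the power object of \<open>Z\<close> by a
  formula of the internal language, and the intersection of this internal family is the least
  closed subobject (\<open>least_closed_subobject\<close>).  The intersection is closed by the usual argument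
  for Horn conditions, and it lies below every closed subobject because each of these has a name
  in the power object.

  The internal language enters in the form of Kripke-Joyal semantics: a predicate on the
  generalized elements of \<open>B\<close> is called definable when a subobject of \<open>B\<close> represents it, and the
  definable predicates are shown to be closed under substitution, finite conjunction, equality,
  and the combination \<open>\<forall>t. Q \<longrightarrow> Q'\<close> (\<open>definable_forall_imp\<close>), which needs exponentials and the
  subobject classifier.

  Transitivity of a relation is stated through relational composition, hence through an image.
  It amounts to a Horn rule only because images exist, and the image of \<open>g\<close> is in turn the least
  subobject closed under the rule without premises whose conclusion is \<open>g\<close> (\<open>image_exists\<close>).
\<close>

section \<open>Generalized elements and definable predicates\<close>

context category
begin

lemma homD:
  assumes "f \<in> hom C X Y"
  shows "f \<in> Arr C" "Dom C f = X" "Cod C f = Y" "X \<in> Obj C" "Y \<in> Obj C"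
  using assms hom_Obj[OF assms] by (auto simp: hom_def)

lemma mono_hom:
  assumes "is_mono C m" "Cod C m = B"
  shows "m \<in> hom C (Dom C m) B"
  using assms by (auto simp: is_mono_def hom_def)

lemma mono_cancel:
  assumes "is_mono C m" "a \<in> hom C W (Dom C m)" "b \<in> hom C W (Dom C m)" "m \<cdot> a = m \<cdot> b"
  shows "a = b"
  using assms unfolding is_mono_def by blast

lemma monoI:
  assumes "m \<in> hom C D B"
    and "\<And>W a b. a \<in> hom C W D \<Longrightarrow> b \<in> hom C W D \<Longrightarrow> m \<cdot> a = m \<cdot> b \<Longrightarrow> a = b"
  shows "is_mono C m" "Cod C m = B"
  using assms(2) homD[OF assms(1)] unfolding is_mono_def by blast+

lemma factorsI:
  assumes "h \<in> hom C W D" "m \<in> hom C D B"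
  shows "factors C (m \<cdot> h) m"
  using homD[OF assms(2)] homD[OF Comp_hom[OF assms]] assms(1) by (auto simp: factors_def)

lemma factors_iff:
  assumes "f \<in> hom C W B" "m \<in> hom C D B'"
  shows "factors C f m \<longleftrightarrow> (\<exists>h \<in> hom C W D. m \<cdot> h = f)"
  using homD(2)[OF assms(1)] homD(2)[OF assms(2)] by (simp add: factors_def)

lemma factors_precomp:
  assumes "factors C f m" and f: "f \<in> hom C W B" and m: "m \<in> hom C D B" and w: "w \<in> hom C V W"
  shows "factors C (f \<cdot> w) m"
proof -
  obtain h where h: "h \<in> hom C W D" "m \<cdot> h = f"
    using assms(1) factors_iff[OF f m] by blast
  have "f \<cdot> w = m \<cdot> (h \<cdot> w)" using Comp_assoc[OF w h(1) m] h(2) by simp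
  then show ?thesis using factorsI[OF Comp_hom[OF w h(1)] m] by simp
qed

text \<open>
  A subobject is determined by the generalized elements, at all stages \<open>W\<close>, that belong to it.
  Predicates can therefore stand for the subobjects that represent them, with inverse images and
  intersections turned into substitution and conjunction.
\<close>

definition definable :: "'o \<Rightarrow> ('m \<Rightarrow> bool) \<Rightarrow> bool" where
  "definable B Q \<longleftrightarrow>
     (\<exists>m. is_mono C m \<and> Cod C m = B \<and> (\<forall>W. \<forall>a \<in> hom C W B. factors C a m \<longleftrightarrow> Q a))"

lemma definableE:
  assumes "definable B Q"
  obtains m D where "is_mono C m" "Cod C m = B" "m \<in> hom C D B"
    "\<And>W a. a \<in> hom C W B \<Longrightarrow> factors C a m \<longleftrightarrow> Q a"
  using assms mono_hom unfolding definable_def by blast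

lemma definableI:
  assumes "is_mono C m" "Cod C m = B" "\<And>W a. a \<in> hom C W B \<Longrightarrow> factors C a m \<longleftrightarrow> Q a"
  shows "definable B Q"
  using assms unfolding definable_def by blast

lemma definable_factors:
  assumes "is_mono C m" "Cod C m = B"
  shows "definable B (\<lambda>a. factors C a m)"
  using assms by (rule definableI) simp

lemma definable_cong:
  assumes "definable B Q" "\<And>W a. a \<in> hom C W B \<Longrightarrow> Q a \<longleftrightarrow> Q' a"
  shows "definable B Q'"
  using assms unfolding definable_def by metis

lemma definable_True:
  assumes "B \<in> Obj C"
  shows "definable B (\<lambda>a. True)"
proof -
  note I = Ide_hom[OF assms]
  have m: "is_mono C (Ide C B)" "Cod C (Ide C B) = B"
    using monoI[OF I] Ide_Comp by metis+
  show ?thesis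
  proof (rule definableI[OF m])
    fix W a assume a: "a \<in> hom C W B"
    show "factors C a (Ide C B) \<longleftrightarrow> True" using factorsI[OF a I] Ide_Comp[OF a] by simp
  qed
qed

end

context finitely_complete_category
begin

lemma pairing_Comp:
  assumes a: "a \<in> hom C W X" and b: "b \<in> hom C W Y" and w: "w \<in> hom C V W"
  shows "pairing C a b \<cdot> w = pairing C (a \<cdot> w) (b \<cdot> w)"
proof -
  note P = pairing[OF a b] and P' = pairing[OF Comp_hom[OF w a] Comp_hom[OF w b]]
  have O: "X \<in> Obj C" "Y \<in> Obj C" using homD a b by auto
  show ?thesis
    using product_ext[OF O Comp_hom[OF w P(1)] P'(1)] Comp_assoc[OF w P(1) proj_hom(1)[OF O]]
      Comp_assoc[OF w P(1) proj_hom(2)[OF O]] P(2,3) P'(2,3) by simp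
qed

lemma pairing_proj:
  assumes O: "X \<in> Obj C" "Y \<in> Obj C" and h: "h \<in> hom C W (prod_obj C X Y)"
  shows "pairing C (proj1 C X Y \<cdot> h) (proj2 C X Y \<cdot> h) = h"
  using product_ext[OF O _ h] pairing[OF Comp_hom[OF h proj_hom(1)[OF O]] Comp_hom[OF h proj_hom(2)[OF O]]]
  by simp

lemma prod_map_pairing:
  assumes f: "f \<in> hom C X X'" and g: "g \<in> hom C Y Y'" and a: "a \<in> hom C W X" and b: "b \<in> hom C W Y"
  shows "prod_map C f g \<cdot> pairing C a b = pairing C (f \<cdot> a) (g \<cdot> b)"
proof -
  have O: "X \<in> Obj C" "Y \<in> Obj C" using homD f g by auto
  note D = homD(2)[OF f] homD(2)[OF g]
  note Q = proj_hom(1,2)[OF O] and P = pairing[OF a b]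
  show ?thesis
    using pairing_Comp[OF Comp_hom[OF Q(1) f] Comp_hom[OF Q(2) g] P(1)]
      Comp_assoc[OF P(1) Q(1) f] Comp_assoc[OF P(1) Q(2) g] P(2,3)
    by (simp add: prod_map_def D)
qed

lemma pairing_mono:
  assumes "B \<in> Obj C"
  shows "is_mono C (pairing C (Ide C B) (Ide C B))"
    "Cod C (pairing C (Ide C B) (Ide C B)) = prod_obj C B B"
proof -
  note I = Ide_hom[OF assms]
  have *: "a = b" if "a \<in> hom C W B" "b \<in> hom C W B"
    "pairing C (Ide C B) (Ide C B) \<cdot> a = pairing C (Ide C B) (Ide C B) \<cdot> b" for W a b
    using that pairing_Comp[OF I I that(1)] pairing_Comp[OF I I that(2)]
      pairing(2)[OF that(1,1)] pairing(2)[OF that(2,2)] Ide_Comp by metis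
  show "is_mono C (pairing C (Ide C B) (Ide C B))"
    "Cod C (pairing C (Ide C B) (Ide C B)) = prod_obj C B B"
    using monoI[OF pairing(1)[OF I I]] * by blast+
qed

lemma pullback_hom:
  assumes "is_pullback C f g p q" "f \<in> hom C X Z" "g \<in> hom C Y Z"
  shows "p \<in> hom C (Dom C p) X" "q \<in> hom C (Dom C p) Y" "f \<cdot> p = g \<cdot> q"
  using assms by (auto simp: is_pullback_def hom_def)

text \<open>
  Membership in an inverse image is membership of the image element: the universal property of
  the pullback, with uniqueness absorbed by \<open>m\<close> being monic.
\<close>

lemma pullback_mono:
  assumes pb: "is_pullback C f m p q" and f: "f \<in> hom C X Z" and m: "is_mono C m" "m \<in> hom C Y Z"
  shows "is_mono C p" "Cod C p = X"
    and "a \<in> hom C W X \<Longrightarrow> factors C a p \<longleftrightarrow> factors C (f \<cdot> a) m"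
proof -
  note H = pullback_hom[OF pb f m(2)]
  have *: "a = b" if a: "a \<in> hom C V (Dom C p)" and b: "b \<in> hom C V (Dom C p)" and e: "p \<cdot> a = p \<cdot> b" for V a b
  proof -
    have "m \<cdot> (q \<cdot> a) = f \<cdot> (p \<cdot> a)" "m \<cdot> (q \<cdot> b) = f \<cdot> (p \<cdot> b)"
      using Comp_assoc[OF a H(2) m(2)] Comp_assoc[OF a H(1) f]
        Comp_assoc[OF b H(2) m(2)] Comp_assoc[OF b H(1) f] H(3) by simp_all
    then have "q \<cdot> a = q \<cdot> b"
      using mono_cancel[OF m(1)] Comp_hom[OF a H(2)] Comp_hom[OF b H(2)] e homD(2)[OF m(2)] by metis
    moreover have "\<exists>!h. h \<in> hom C V (Dom C p) \<and> p \<cdot> h = p \<cdot> a \<and> q \<cdot> h = q \<cdot> a"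
      using pullback_univ[OF pb f m(2) Comp_hom[OF a H(1)] Comp_hom[OF a H(2)]]
        \<open>m \<cdot> (q \<cdot> a) = _\<close> by simp
    ultimately show ?thesis using a b e by metis
  qed
  show "is_mono C p" "Cod C p = X" using monoI[OF H(1)] * by blast+
  show "factors C a p \<longleftrightarrow> factors C (f \<cdot> a) m" if a: "a \<in> hom C W X"
  proof
    assume "factors C a p"
    then obtain h where h: "h \<in> hom C W (Dom C p)" "p \<cdot> h = a" using factors_iff[OF a H(1)] by blast
    have "f \<cdot> a = m \<cdot> (q \<cdot> h)"
      using Comp_assoc[OF h(1) H(2) m(2)] Comp_assoc[OF h(1) H(1) f] H(3) h(2) by simp
    then show "factors C (f \<cdot> a) m" using factorsI[OF Comp_hom[OF h(1) H(2)] m(2)] by simp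
  next
    assume "factors C (f \<cdot> a) m"
    then obtain b where b: "b \<in> hom C W Y" "m \<cdot> b = f \<cdot> a"
      using factors_iff[OF Comp_hom[OF a f] m(2)] by blast
    obtain h where "h \<in> hom C W (Dom C p)" "p \<cdot> h = a"
      using pullback_univ[OF pb f m(2) a b(1)] b(2) by auto
    then show "factors C a p" using factors_iff[OF a H(1)] by blast
  qed
qed

lemma definable_subst:
  assumes "definable B Q" and f: "f \<in> hom C A B"
  shows "definable A (\<lambda>a. Q (f \<cdot> a))"
proof -
  obtain m D where m: "is_mono C m" "m \<in> hom C D B"
    "\<And>W a. a \<in> hom C W B \<Longrightarrow> factors C a m \<longleftrightarrow> Q a"
    using definableE[OF assms(1)] by metis
  obtain p q where pb: "is_pullback C f m p q" using pullback_exists[OF f m(2)] by blast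
  show ?thesis
  proof (rule definableI[OF pullback_mono(1,2)[OF pb f m(1,2)]])
    fix W a assume a: "a \<in> hom C W A"
    show "factors C a p \<longleftrightarrow> Q (f \<cdot> a)"
      using pullback_mono(3)[OF pb f m(1,2) a] m(3)[OF Comp_hom[OF a f]] by simp
  qed
qed

text \<open>
  The intersection is built as a composite: with \<open>m\<close> representing \<open>Q\<close>, the part of the domain of
  \<open>m\<close> on which \<open>Q'\<close> holds is included in \<open>B\<close> through \<open>m\<close>.
\<close>

lemma definable_conj:
  assumes "definable B Q" "definable B Q'"
  shows "definable B (\<lambda>a. Q a \<and> Q' a)"
proof -
  obtain m D where m: "is_mono C m" "m \<in> hom C D B"
    "\<And>W a. a \<in> hom C W B \<Longrightarrow> factors C a m \<longleftrightarrow> Q a"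
    using definableE[OF assms(1)] by metis
  obtain p E where p: "is_mono C p" "p \<in> hom C E D"
    "\<And>W a. a \<in> hom C W D \<Longrightarrow> factors C a p \<longleftrightarrow> Q' (m \<cdot> a)"
    using definableE[OF definable_subst[OF assms(2) m(2)]] by metis
  have mp: "m \<cdot> p \<in> hom C E B" using Comp_hom p(2) m(2) .
  have *: "a = b" if "a \<in> hom C W E" "b \<in> hom C W E" "(m \<cdot> p) \<cdot> a = (m \<cdot> p) \<cdot> b" for W a b
  proof -
    have "m \<cdot> (p \<cdot> a) = m \<cdot> (p \<cdot> b)"
      using that(3) Comp_assoc[OF _ p(2) m(2)] that by simp
    then have "p \<cdot> a = p \<cdot> b"
      using mono_cancel[OF m(1)] homD(2)[OF m(2)] Comp_hom[OF _ p(2)] that by metis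
    then show ?thesis using mono_cancel[OF p(1)] homD(2)[OF p(2)] that by metis
  qed
  have mono: "is_mono C (m \<cdot> p)" "Cod C (m \<cdot> p) = B" using monoI[OF mp] * by blast+
  show ?thesis
  proof (rule definableI[OF mono])
    fix W a assume a: "a \<in> hom C W B"
    show "factors C a (m \<cdot> p) \<longleftrightarrow> Q a \<and> Q' a"
    proof
      assume "factors C a (m \<cdot> p)"
      then obtain h where h: "h \<in> hom C W E" "(m \<cdot> p) \<cdot> h = a" using factors_iff[OF a mp] by blast
      have e: "m \<cdot> (p \<cdot> h) = a" using h Comp_assoc[OF h(1) p(2) m(2)] by simp
      note ph = Comp_hom[OF h(1) p(2)]
      have "Q a" using factorsI[OF ph m(2)] e m(3) a by simp
      moreover have "Q' a" using factorsI[OF h(1) p(2)] p(3)[OF ph] e by simp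
      ultimately show "Q a \<and> Q' a" ..
    next
      assume "Q a \<and> Q' a"
      then obtain k where k: "k \<in> hom C W D" "m \<cdot> k = a" using factors_iff[OF a m(2)] m(3)[OF a] by blast
      then have "factors C k p" using p(3) \<open>Q a \<and> Q' a\<close> by simp
      then obtain h where h: "h \<in> hom C W E" "p \<cdot> h = k" using factors_iff[OF k(1) p(2)] by blast
      have "(m \<cdot> p) \<cdot> h = a" using h k Comp_assoc[OF h(1) p(2) m(2)] by simp
      then show "factors C a (m \<cdot> p)" using factorsI[OF h(1) mp] by simp
    qed
  qed
qed

lemma definable_finite_conj:
  assumes "finite I" "B \<in> Obj C" "\<And>i. i \<in> I \<Longrightarrow> definable B (Q i)"
  shows "definable B (\<lambda>a. \<forall>i\<in>I. Q i a)"
  using assms(1,3)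
proof (induction I)
  case empty
  show ?case using definable_True[OF assms(2)] by simp
next
  case (insert i I)
  then show ?case using definable_conj[of B "Q i" "\<lambda>a. \<forall>i\<in>I. Q i a"] by simp
qed

text \<open>The equalizer of \<open>k\<close> and \<open>k'\<close>, as the inverse image of the diagonal along \<open>\<langle>k, k'\<rangle>\<close>.\<close>

lemma definable_eq:
  assumes k: "k \<in> hom C B Y" and k': "k' \<in> hom C B Y"
  shows "definable B (\<lambda>b. k \<cdot> b = k' \<cdot> b)"
proof -
  have Y: "Y \<in> Obj C" using homD k by auto
  let ?d = "pairing C (Ide C Y) (Ide C Y)"
  note I = Ide_hom[OF Y]
  have d: "?d \<in> hom C Y (prod_obj C Y Y)" using pairing(1)[OF I I] .
  show ?thesis
  proof (rule definable_cong[OF definable_subst[OF definable_factors[OF pairing_mono[OF Y]] pairing(1)[OF k k']]])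
    fix W b assume b: "b \<in> hom C W B"
    note kb = Comp_hom[OF b k] Comp_hom[OF b k']
    have e: "pairing C k k' \<cdot> b = pairing C (k \<cdot> b) (k' \<cdot> b)" using pairing_Comp[OF k k' b] .
    have de: "?d \<cdot> y = pairing C y y" if "y \<in> hom C W Y" for y
      using pairing_Comp[OF I I that] Ide_Comp[OF that] by simp
    show "factors C (pairing C k k' \<cdot> b) ?d \<longleftrightarrow> k \<cdot> b = k' \<cdot> b"
    proof
      assume "factors C (pairing C k k' \<cdot> b) ?d"
      then obtain y where y: "y \<in> hom C W Y" "?d \<cdot> y = pairing C (k \<cdot> b) (k' \<cdot> b)"
        using factors_iff[OF pairing(1)[OF kb] d] e by auto
      then have "pairing C y y = pairing C (k \<cdot> b) (k' \<cdot> b)" using de by simp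
      then show "k \<cdot> b = k' \<cdot> b" using pairing(2,3)[OF y(1,1)] pairing(2,3)[OF kb] by metis
    next
      assume "k \<cdot> b = k' \<cdot> b"
      then show "factors C (pairing C k k' \<cdot> b) ?d" using factorsI[OF kb(1) d] de[OF kb(1)] e by simp
    qed
  qed
qed

end

section \<open>Truth values and power objects\<close>

locale topos_category = finitely_complete_category +
  fixes true :: 'b
  assumes exponential_exists:
      "A \<in> Obj C \<Longrightarrow> B \<in> Obj C \<Longrightarrow> \<exists>P ev. is_exponential C A B P ev"
    and classifier: "is_subobject_classifier C true"
begin

definition \<Omega> :: 'a where "\<Omega> = Cod C true"

lemma true_hom: "true \<in> hom C (Dom C true) \<Omega>"
  using classifier by (simp add: is_subobject_classifier_def \<Omega>_def hom_def)

lemma terminal_unique: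
  assumes "a \<in> hom C W (Dom C true)" "b \<in> hom C W (Dom C true)"
  shows "a = b"
proof -
  have "\<exists>!u. u \<in> hom C W (Dom C true)"
    using classifier homD[OF assms(1)] by (simp add: is_subobject_classifier_def is_terminal_def)
  then show ?thesis using assms by blast
qed

lemma true_mono: "is_mono C true"
  using monoI(1)[OF true_hom] terminal_unique by blast

lemma classifying_arrow:
  assumes "definable B Q"
  obtains \<chi> where "\<chi> \<in> hom C B \<Omega>" "\<And>W a. a \<in> hom C W B \<Longrightarrow> factors C (\<chi> \<cdot> a) true \<longleftrightarrow> Q a"
proof -
  obtain m D where m: "is_mono C m" "Cod C m = B"
    "\<And>W a. a \<in> hom C W B \<Longrightarrow> factors C a m \<longleftrightarrow> Q a"
    using definableE[OF assms] by metis
  have "\<exists>!\<chi>. \<chi> \<in> hom C B \<Omega> \<and> (\<exists>u. is_pullback C \<chi> true m u)"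
    using classifier m(1,2) unfolding is_subobject_classifier_def \<Omega>_def by blast
  then obtain \<chi> u where c: "\<chi> \<in> hom C B \<Omega>" "is_pullback C \<chi> true m u" by blast
  show ?thesis using that[OF c(1)] pullback_mono(3)[OF c(2,1) true_mono true_hom] m(3) by metis
qed

text \<open>
  Extensionality for predicates: both arrows classify the subobject obtained by pulling \<open>true\<close>
  back along \<open>\<chi>\<close>, so uniqueness of the classifying arrow applies.
\<close>

lemma truth_value_ext:
  assumes c: "\<chi> \<in> hom C B \<Omega>" and c': "\<chi>' \<in> hom C B \<Omega>"
    and iff: "\<And>W a. a \<in> hom C W B \<Longrightarrow> factors C (\<chi> \<cdot> a) true \<longleftrightarrow> factors C (\<chi>' \<cdot> a) true"
  shows "\<chi> = \<chi>'"
proof -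
  obtain m u where pb: "is_pullback C \<chi> true m u" using pullback_exists[OF c true_hom] by blast
  note M = pullback_mono[OF pb c true_mono true_hom]
  note H = pullback_hom[OF pb c true_hom]
  have "factors C (\<chi> \<cdot> m) true" using M(3)[OF H(1)] factors_refl homD(1)[OF H(1)] by blast
  then obtain u' where u': "u' \<in> hom C (Dom C m) (Dom C true)" "true \<cdot> u' = \<chi>' \<cdot> m"
    using factors_iff[OF Comp_hom[OF H(1) c'] true_hom] iff[OF H(1)] by blast
  have "is_pullback C \<chi>' true m u'"
    unfolding is_pullback_def
  proof (intro conjI ballI impI)
    show "{\<chi>', true, m, u'} \<subseteq> Arr C" "Cod C \<chi>' = Cod C true" "Dom C m = Dom C u'"
      "Cod C m = Dom C \<chi>'" "Cod C u' = Dom C true" "\<chi>' \<cdot> m = true \<cdot> u'"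
      using homD[OF c'] homD[OF true_hom] homD[OF H(1)] homD[OF u'(1)] u'(2) by auto
    fix W a b assume W: "W \<in> Obj C" and "a \<in> hom C W (Dom C \<chi>')" and b: "b \<in> hom C W (Dom C true)"
      and e: "\<chi>' \<cdot> a = true \<cdot> b"
    then have a: "a \<in> hom C W B" using homD[OF c'] by simp
    have "factors C (\<chi>' \<cdot> a) true" using factorsI[OF b true_hom] e by simp
    then have "factors C a m" using M(3) iff a by simp
    then obtain h where h: "h \<in> hom C W (Dom C m)" "m \<cdot> h = a" using factors_iff[OF a H(1)] by blast
    show "\<exists>!h. h \<in> hom C W (Dom C m) \<and> m \<cdot> h = a \<and> u' \<cdot> h = b"
      using h terminal_unique[OF Comp_hom[OF _ u'(1)] b] mono_cancel[OF M(1)] by metis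
  qed
  then show ?thesis
    using classifier M(1,2) c c' pb unfolding is_subobject_classifier_def \<Omega>_def by blast
qed

lemma transpose_Comp:
  assumes ev: "ev \<in> hom C (prod_obj C P A) B" and A: "A \<in> Obj C"
    and k: "k \<in> hom C Z P" and b: "b \<in> hom C W Z"
  shows "ev \<cdot> prod_map C (k \<cdot> b) (Ide C A) = (ev \<cdot> prod_map C k (Ide C A)) \<cdot> prod_map C b (Ide C A)"
proof -
  note I = Ide_hom[OF A]
  show ?thesis
    using prod_map_Comp[OF b I k I] Ide_Comp[OF I]
      Comp_assoc[OF prod_map(1)[OF b I] prod_map(1)[OF k I] ev] by simp
qed

text \<open>
  Universal quantification comes from exponentials.  The implication \<open>Q \<longrightarrow> Q'\<close> holds
  everywhere exactly when \<open>Q\<close> and \<open>Q \<and> Q'\<close> are the same predicate.  Transposing the classifying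
  arrows of these two gives arrows from \<open>B\<close> into the exponential \<open>\<Omega>\<^sup>T\<close>, and they agree at \<open>b\<close> if
  and only if the two predicates agree on the fibre over \<open>b\<close>.  The stage change \<open>w\<close> makes the
  quantification range over the elements of \<open>T\<close> at all later stages.
\<close>

lemma definable_forall_imp:
  assumes T: "T \<in> Obj C" and B: "B \<in> Obj C"
    and Q: "definable (prod_obj C B T) Q" and Q': "definable (prod_obj C B T) Q'"
  shows "definable B (\<lambda>b. \<forall>V w t. w \<in> hom C V (Dom C b) \<longrightarrow> t \<in> hom C V T \<longrightarrow>
           Q (pairing C (b \<cdot> w) t) \<longrightarrow> Q' (pairing C (b \<cdot> w) t))"
proof -
  let ?BT = "prod_obj C B T"
  obtain \<chi> where c: "\<chi> \<in> hom C ?BT \<Omega>"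
    "\<And>W a. a \<in> hom C W ?BT \<Longrightarrow> factors C (\<chi> \<cdot> a) true \<longleftrightarrow> Q a"
    using classifying_arrow[OF Q] by metis
  obtain \<chi>' where c': "\<chi>' \<in> hom C ?BT \<Omega>"
    "\<And>W a. a \<in> hom C W ?BT \<Longrightarrow> factors C (\<chi>' \<cdot> a) true \<longleftrightarrow> Q a \<and> Q' a"
    using classifying_arrow[OF definable_conj[OF Q Q']] by metis
  have O: "\<Omega> \<in> Obj C" using homD true_hom by blast
  obtain P ev where "is_exponential C T \<Omega> P ev" using exponential_exists[OF T O] by blast
  then have ev: "ev \<in> hom C (prod_obj C P T) \<Omega>"
    and exp: "\<And>Z h. Z \<in> Obj C \<Longrightarrow> h \<in> hom C (prod_obj C Z T) \<Omega> \<Longrightarrow>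
      \<exists>!k. k \<in> hom C Z P \<and> ev \<cdot> prod_map C k (Ide C T) = h"
    by (auto simp: is_exponential_def)
  obtain k where k: "k \<in> hom C B P" "ev \<cdot> prod_map C k (Ide C T) = \<chi>" using exp[OF B c(1)] by blast
  obtain k' where k': "k' \<in> hom C B P" "ev \<cdot> prod_map C k' (Ide C T) = \<chi>'" using exp[OF B c'(1)] by blast
  note I = Ide_hom[OF T]
  show ?thesis
  proof (rule definable_cong[OF definable_eq[OF k(1) k'(1)]])
    fix W b assume b: "b \<in> hom C W B"
    note W = homD(4)[OF b]
    let ?b = "prod_map C b (Ide C T)"
    note bT = prod_map(1)[OF b I]
    have tr: "ev \<cdot> prod_map C (k \<cdot> b) (Ide C T) = \<chi> \<cdot> ?b"
      "ev \<cdot> prod_map C (k' \<cdot> b) (Ide C T) = \<chi>' \<cdot> ?b"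
      using transpose_Comp[OF ev T k(1) b] transpose_Comp[OF ev T k'(1) b] k(2) k'(2) by simp_all
    \<comment> \<open>Transposition is injective.\<close>
    have "k \<cdot> b = k' \<cdot> b \<longleftrightarrow> \<chi> \<cdot> ?b = \<chi>' \<cdot> ?b"
      using tr exp[OF W Comp_hom[OF bT c(1)]] Comp_hom[OF b k(1)] Comp_hom[OF b k'(1)] by metis
    also have "\<dots> \<longleftrightarrow> (\<forall>V w t. w \<in> hom C V W \<longrightarrow> t \<in> hom C V T \<longrightarrow>
           Q (pairing C (b \<cdot> w) t) \<longrightarrow> Q' (pairing C (b \<cdot> w) t))" (is "_ \<longleftrightarrow> ?R")
    proof
      assume e: "\<chi> \<cdot> ?b = \<chi>' \<cdot> ?b"
      show ?R
      proof (intro allI impI)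
        fix V w t assume w: "w \<in> hom C V W" and t: "t \<in> hom C V T" and q: "Q (pairing C (b \<cdot> w) t)"
        note p = pairing(1)[OF w t] and bp = pairing(1)[OF Comp_hom[OF w b] t]
        have x: "?b \<cdot> pairing C w t = pairing C (b \<cdot> w) t"
          using prod_map_pairing[OF b I w t] Ide_Comp[OF t] by simp
        have "\<chi> \<cdot> pairing C (b \<cdot> w) t = \<chi>' \<cdot> pairing C (b \<cdot> w) t"
          using Comp_assoc[OF p bT c(1)] Comp_assoc[OF p bT c'(1)] x e by simp
        then show "Q' (pairing C (b \<cdot> w) t)" using c(2)[OF bp] c'(2)[OF bp] q by simp
      qed
    next
      assume r: ?R
      show "\<chi> \<cdot> ?b = \<chi>' \<cdot> ?b"
      proof (rule truth_value_ext[OF Comp_hom[OF bT c(1)] Comp_hom[OF bT c'(1)]])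
        fix V a assume a: "a \<in> hom C V (prod_obj C W T)"
        note w = Comp_hom[OF a proj_hom(1)[OF W T]] and t = Comp_hom[OF a proj_hom(2)[OF W T]]
        note ba = Comp_hom[OF a bT]
        have x: "?b \<cdot> a = pairing C (b \<cdot> (proj1 C W T \<cdot> a)) (proj2 C W T \<cdot> a)"
          using prod_map_pairing[OF b I w t] Ide_Comp[OF t] pairing_proj[OF W T a] by simp
        have "Q (?b \<cdot> a) \<longleftrightarrow> Q (?b \<cdot> a) \<and> Q' (?b \<cdot> a)" using r w t x by metis
        then show "factors C ((\<chi> \<cdot> ?b) \<cdot> a) true \<longleftrightarrow> factors C ((\<chi>' \<cdot> ?b) \<cdot> a) true"
          using c(2)[OF ba] c'(2)[OF ba] Comp_assoc[OF a bT c(1)] Comp_assoc[OF a bT c'(1)] by simp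
      qed
    qed
    finally show "k \<cdot> b = k' \<cdot> b \<longleftrightarrow> (\<forall>V w t. w \<in> hom C V (Dom C b) \<longrightarrow> t \<in> hom C V T \<longrightarrow>
           Q (pairing C (b \<cdot> w) t) \<longrightarrow> Q' (pairing C (b \<cdot> w) t))" using homD(2)[OF b] by simp
  qed
qed

text \<open>
  \<open>M\<close> is the membership predicate of the power object \<open>P\<close>, and the last clause is comprehension:
  a definable family of subobjects of \<open>Z\<close> indexed by \<open>B\<close> is named by an arrow from \<open>B\<close> to \<open>P\<close>.
\<close>

lemma power_object:
  assumes Z: "Z \<in> Obj C"
  obtains P M where "P \<in> Obj C" "definable (prod_obj C P Z) M"
    "\<And>B Q. B \<in> Obj C \<Longrightarrow> definable (prod_obj C B Z) Q \<Longrightarrow>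
       \<exists>u \<in> hom C B P. \<forall>W. \<forall>b \<in> hom C W B. \<forall>z \<in> hom C W Z.
         M (pairing C (u \<cdot> b) z) \<longleftrightarrow> Q (pairing C b z)"
proof -
  have O: "\<Omega> \<in> Obj C" using homD true_hom by blast
  obtain P ev where "is_exponential C Z \<Omega> P ev" using exponential_exists[OF Z O] by blast
  then have P: "P \<in> Obj C" and ev: "ev \<in> hom C (prod_obj C P Z) \<Omega>"
    and exp: "\<And>B h. B \<in> Obj C \<Longrightarrow> h \<in> hom C (prod_obj C B Z) \<Omega> \<Longrightarrow>
      \<exists>!k. k \<in> hom C B P \<and> ev \<cdot> prod_map C k (Ide C Z) = h"
    by (auto simp: is_exponential_def)
  let ?M = "\<lambda>a. factors C (ev \<cdot> a) true"
  have "definable (prod_obj C P Z) ?M"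
    using definable_subst[OF definable_factors[OF true_mono] ev] homD(3)[OF true_hom] by simp
  moreover have "\<exists>u \<in> hom C B P. \<forall>W. \<forall>b \<in> hom C W B. \<forall>z \<in> hom C W Z.
         ?M (pairing C (u \<cdot> b) z) \<longleftrightarrow> Q (pairing C b z)"
    if B: "B \<in> Obj C" and Q: "definable (prod_obj C B Z) Q" for B Q
  proof -
    obtain \<chi> where c: "\<chi> \<in> hom C (prod_obj C B Z) \<Omega>"
      "\<And>W a. a \<in> hom C W (prod_obj C B Z) \<Longrightarrow> factors C (\<chi> \<cdot> a) true \<longleftrightarrow> Q a"
      using classifying_arrow[OF Q] by metis
    obtain u where u: "u \<in> hom C B P" "ev \<cdot> prod_map C u (Ide C Z) = \<chi>" using exp[OF B c(1)] by blast
    note I = Ide_hom[OF Z]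
    have "?M (pairing C (u \<cdot> b) z) \<longleftrightarrow> Q (pairing C b z)" if b: "b \<in> hom C W B" and z: "z \<in> hom C W Z" for W b z
    proof -
      note p = pairing(1)[OF b z]
      have "ev \<cdot> pairing C (u \<cdot> b) z = \<chi> \<cdot> pairing C b z"
        using prod_map_pairing[OF u(1) I b z] Ide_Comp[OF z] u(2)
          Comp_assoc[OF p prod_map(1)[OF u(1) I] ev] by simp
      then show ?thesis using c(2)[OF p] by simp
    qed
    with u(1) show ?thesis by blast
  qed
  ultimately show ?thesis using that[OF P] by blast
qed

end

section \<open>Subobjects closed under Horn rules\<close>

text \<open>
  A rule \<open>(ps, c)\<close> has premises \<open>ps\<close> and conclusion \<open>c\<close>, all of them arrows from one object of
  parameters, which is read off as the domain of \<open>c\<close>.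
\<close>

definition closed_under :: "('o, 'm) cat \<Rightarrow> 'm \<Rightarrow> 'm set \<times> 'm \<Rightarrow> bool" where
  "closed_under C m = (\<lambda>(ps, c). \<forall>W. \<forall>t \<in> hom C W (Dom C c).
     (\<forall>p \<in> ps. factors C (p \<cdot>\<^bsub>C\<^esub> t) m) \<longrightarrow> factors C (c \<cdot>\<^bsub>C\<^esub> t) m)"

definition is_rule :: "('o, 'm) cat \<Rightarrow> 'o \<Rightarrow> 'm set \<times> 'm \<Rightarrow> bool" where
  "is_rule C Z = (\<lambda>(ps, c). finite ps \<and> insert c ps \<subseteq> hom C (Dom C c) Z)"

context category
begin

text \<open>A rule without premises says that its conclusion, as a generalized element, is a member.\<close>

lemma closed_under_axiom_iff:
  assumes "g \<in> hom C X Y" "is_mono C n" "Cod C n = Y"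
  shows "closed_under C n ({}, g) \<longleftrightarrow> factors C g n"
  using factors_precomp[OF _ assms(1) mono_hom[OF assms(2,3)]] Ide_hom[OF homD(4)[OF assms(1)]]
    Comp_Ide[OF assms(1)] homD(2)[OF assms(1)]
  unfolding closed_under_def split by (metis empty_iff)

end

context topos_category
begin

text \<open>
  The internal intersection of all closed subobjects: \<open>z\<close> belongs to it when \<open>z\<close> belongs to every
  element \<open>u\<close> of the power object that is closed under the rules.  Leastness is obtained by
  instantiating \<open>u\<close> with the name of a given closed subobject \<open>n\<close>.
\<close>

theorem least_closed_subobject:
  assumes Z: "Z \<in> Obj C" and fin: "finite H" and rules: "\<And>\<rho>. \<rho> \<in> H \<Longrightarrow> is_rule C Z \<rho>"
  obtains m where "is_mono C m" "Cod C m = Z" "\<And>\<rho>. \<rho> \<in> H \<Longrightarrow> closed_under C m \<rho>"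
    "\<And>n. is_mono C n \<Longrightarrow> Cod C n = Z \<Longrightarrow> (\<And>\<rho>. \<rho> \<in> H \<Longrightarrow> closed_under C n \<rho>) \<Longrightarrow> factors C m n"
proof -
  obtain P M where P: "P \<in> Obj C" and M: "definable (prod_obj C P Z) M"
    and comprehension: "\<And>B Q. B \<in> Obj C \<Longrightarrow> definable (prod_obj C B Z) Q \<Longrightarrow>
       \<exists>u \<in> hom C B P. \<forall>W. \<forall>b \<in> hom C W B. \<forall>z \<in> hom C W Z.
         M (pairing C (u \<cdot> b) z) \<longleftrightarrow> Q (pairing C b z)"
    using power_object[OF Z] by metis
  have rule: "finite ps" "c \<in> hom C (Dom C c) Z" "\<And>p. p \<in> ps \<Longrightarrow> p \<in> hom C (Dom C c) Z"
    if "(ps, c) \<in> H" for ps c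
    using rules[OF that] by (auto simp: is_rule_def)
  \<comment> \<open>The internal counterpart of \<open>closed_under\<close>, for an element \<open>u\<close> of the power object.\<close>
  define closed where "closed = (\<lambda>(ps, c) u. \<forall>V w t. w \<in> hom C V (Dom C u) \<longrightarrow> t \<in> hom C V (Dom C c) \<longrightarrow>
      (\<forall>p\<in>ps. M (pairing C (u \<cdot> w) (p \<cdot> t))) \<longrightarrow> M (pairing C (u \<cdot> w) (c \<cdot> t)))"
  have closed: "definable P (closed \<rho>)" if "\<rho> \<in> H" for \<rho>
  proof -
    obtain ps c where \<rho>: "\<rho> = (ps, c)" by (cases \<rho>)
    note r = rule[OF that[unfolded \<rho>]]
    let ?T = "Dom C c"
    have T: "?T \<in> Obj C" using homD r(2) by blast
    note pi = proj_hom[OF P T]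
    \<comment> \<open>Substitution along \<open>id \<times> p\<close> turns \<open>M\<close> into the predicate \<open>p t \<in> u\<close> of \<open>(u, t)\<close>.\<close>
    let ?f = "\<lambda>p. pairing C (proj1 C P ?T) (p \<cdot> proj2 C P ?T)"
    have f: "?f p \<in> hom C (prod_obj C P ?T) (prod_obj C P Z)"
      "\<And>V u t. u \<in> hom C V P \<Longrightarrow> t \<in> hom C V ?T \<Longrightarrow> ?f p \<cdot> pairing C u t = pairing C u (p \<cdot> t)"
      if p: "p \<in> hom C ?T Z" for p
    proof -
      show "?f p \<in> hom C (prod_obj C P ?T) (prod_obj C P Z)" using pairing(1)[OF pi(1) Comp_hom[OF pi(2) p]] .
      fix V u t assume ut: "u \<in> hom C V P" "t \<in> hom C V ?T"
      note q = pairing[OF ut]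
      show "?f p \<cdot> pairing C u t = pairing C u (p \<cdot> t)"
        using pairing_Comp[OF pi(1) Comp_hom[OF pi(2) p] q(1)] q(2,3) Comp_assoc[OF q(1) pi(2) p] by simp
    qed
    have "definable (prod_obj C P ?T) (\<lambda>a. \<forall>p\<in>ps. M (?f p \<cdot> a))"
      using definable_finite_conj[OF r(1) pi(3)] definable_subst[OF M f(1)] r(3) by simp
    moreover have "definable (prod_obj C P ?T) (\<lambda>a. M (?f c \<cdot> a))"
      using definable_subst[OF M f(1)[OF r(2)]] .
    ultimately have D: "definable P (\<lambda>u. \<forall>V w t. w \<in> hom C V (Dom C u) \<longrightarrow> t \<in> hom C V ?T \<longrightarrow>
      (\<forall>p\<in>ps. M (?f p \<cdot> pairing C (u \<cdot> w) t)) \<longrightarrow> M (?f c \<cdot> pairing C (u \<cdot> w) t))"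
      by (rule definable_forall_imp[OF T P])
    show ?thesis
    proof (rule definable_cong[OF D])
      fix W u assume u: "u \<in> hom C W P"
      show "(\<forall>V w t. w \<in> hom C V (Dom C u) \<longrightarrow> t \<in> hom C V ?T \<longrightarrow>
      (\<forall>p\<in>ps. M (?f p \<cdot> pairing C (u \<cdot> w) t)) \<longrightarrow> M (?f c \<cdot> pairing C (u \<cdot> w) t)) \<longleftrightarrow> closed \<rho> u"
        unfolding closed_def \<rho> split homD(2)[OF u]
        using f(2) r(2,3) Comp_hom[OF _ u] by (metis (no_types, lifting))
    qed
  qed
  note pi = proj_hom[OF Z P]
  \<comment> \<open>The quantified variable is the second component in \<open>definable_forall_imp\<close>, whereas \<open>M\<close>
    takes the element of the power object first, so a twist is needed.\<close>
  let ?s = "pairing C (proj2 C Z P) (proj1 C Z P)"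
  have s: "?s \<in> hom C (prod_obj C Z P) (prod_obj C P Z)" using pairing(1)[OF pi(2,1)] .
  have s_eq: "?s \<cdot> pairing C z u = pairing C u z" if "z \<in> hom C V Z" "u \<in> hom C V P" for V z u
    using pairing_Comp[OF pi(2,1) pairing(1)[OF that]] pairing[OF that] by simp
  define S where "S = (\<lambda>z. \<forall>V w u. w \<in> hom C V (Dom C z) \<longrightarrow> u \<in> hom C V P \<longrightarrow>
      (\<forall>\<rho>\<in>H. closed \<rho> u) \<longrightarrow> M (pairing C u (z \<cdot> w)))"
  have "definable (prod_obj C Z P) (\<lambda>a. \<forall>\<rho>\<in>H. closed \<rho> (proj2 C Z P \<cdot> a))"
    using definable_subst[OF definable_finite_conj[OF fin P closed] pi(2)] .
  from definable_forall_imp[OF P Z this definable_subst[OF M s]]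
  have "definable Z S"
  proof (rule definable_cong)
    fix W z assume z: "z \<in> hom C W Z"
    show "(\<forall>V w u. w \<in> hom C V (Dom C z) \<longrightarrow> u \<in> hom C V P \<longrightarrow>
        (\<forall>\<rho>\<in>H. closed \<rho> (proj2 C Z P \<cdot> pairing C (z \<cdot> w) u)) \<longrightarrow> M (?s \<cdot> pairing C (z \<cdot> w) u)) \<longleftrightarrow> S z"
      unfolding S_def homD(2)[OF z]
      using s_eq pairing(3) Comp_hom[OF _ z] by (metis (no_types, lifting))
  qed
  then obtain m D where m: "is_mono C m" "Cod C m = Z" "m \<in> hom C D Z"
    "\<And>W a. a \<in> hom C W Z \<Longrightarrow> factors C a m \<longleftrightarrow> S a"
    using definableE by metis
  show ?thesis
  proof (rule that[OF m(1,2)])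
    fix \<rho> assume H: "\<rho> \<in> H"
    obtain ps c where \<rho>: "\<rho> = (ps, c)" by (cases \<rho>)
    note r = rule[OF H[unfolded \<rho>]]
    show "closed_under C m \<rho>"
      unfolding closed_under_def \<rho> split
    proof (intro allI ballI impI)
      fix W t assume t: "t \<in> hom C W (Dom C c)" and prems: "\<forall>p\<in>ps. factors C (p \<cdot> t) m"
      note ct = Comp_hom[OF t r(2)]
      have "S (c \<cdot> t)"
        unfolding S_def homD(2)[OF ct]
      proof (intro allI impI)
        fix V w u assume w: "w \<in> hom C V W" and u: "u \<in> hom C V P" and cl: "\<forall>\<rho>\<in>H. closed \<rho> u"
        note tw = Comp_hom[OF w t]
        have "M (pairing C u (p \<cdot> (t \<cdot> w)))" if p: "p \<in> ps" for p
        proof -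
          note pt = Comp_hom[OF t r(3)[OF p]]
          have "S (p \<cdot> t)" using prems p m(4)[OF pt] by blast
          then show ?thesis
            using w u cl Comp_assoc[OF w t r(3)[OF p]] unfolding S_def homD(2)[OF pt] by metis
        qed
        moreover have "closed (ps, c) u" using cl H \<rho> by blast
        ultimately have "M (pairing C u (c \<cdot> (t \<cdot> w)))"
          using tw Ide_hom[OF homD(4)[OF u]] Comp_Ide[OF u] unfolding closed_def split homD(2)[OF u]
          by metis
        then show "M (pairing C u ((c \<cdot> t) \<cdot> w))" using Comp_assoc[OF w t r(2)] by simp
      qed
      then show "factors C (c \<cdot> t) m" using m(4)[OF ct] by simp
    qed
  next
    fix n assume n: "is_mono C n" "Cod C n = Z" and cl: "\<And>\<rho>. \<rho> \<in> H \<Longrightarrow> closed_under C n \<rho>"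
    have D: "D \<in> Obj C" using homD m(3) by blast
    note q = proj_hom[OF D Z]
    \<comment> \<open>The name of \<open>n\<close>, as a constant family over the domain of \<open>m\<close>: at this stage \<open>m\<close> is itself
      the generic member of the intersection.\<close>
    obtain u where u: "u \<in> hom C D P" and mem: "\<And>W b z. b \<in> hom C W D \<Longrightarrow> z \<in> hom C W Z \<Longrightarrow>
         M (pairing C (u \<cdot> b) z) \<longleftrightarrow> factors C z n"
      using comprehension[OF D definable_subst[OF definable_factors[OF n] q(2)]] pairing(3) by metis
    have "closed \<rho> u" if H: "\<rho> \<in> H" for \<rho>
    proof -
      obtain ps c where \<rho>: "\<rho> = (ps, c)" by (cases \<rho>)
      note r = rule[OF H[unfolded \<rho>]]
      show ?thesis
        using cl[OF H] mem r(2,3) Comp_hom unfolding closed_def closed_under_def \<rho> split homD(2)[OF u]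
        by (metis (no_types, lifting))
    qed
    moreover have "S m" using m(4)[OF m(3)] factors_refl homD(1)[OF m(3)] by blast
    ultimately have "M (pairing C u (m \<cdot> Ide C D))"
      using u Ide_hom[OF D] unfolding S_def homD(2)[OF m(3)] by blast
    then show "factors C m n" using mem[OF Ide_hom[OF D] m(3)] Comp_Ide[OF m(3)] Comp_Ide[OF u] by simp
  qed
qed

lemma image_exists:
  assumes g: "g \<in> hom C X Y"
  shows "\<exists>m. is_image C g m"
proof -
  have "is_rule C Y ({}, g)" using g homD[OF g] by (simp add: is_rule_def)
  then obtain m where m: "is_mono C m" "Cod C m = Y" "closed_under C m ({}, g)"
    "\<And>n. is_mono C n \<Longrightarrow> Cod C n = Y \<Longrightarrow> closed_under C n ({}, g) \<Longrightarrow> factors C m n"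
    using least_closed_subobject[of Y "{({}, g)}"] homD(5)[OF g] by auto
  then show ?thesis
    using closed_under_axiom_iff[OF g] homD(3)[OF g] unfolding is_image_def by metis
qed

end

section \<open>Reflexivity, transitivity and symmetry as Horn rules\<close>

definition reflexivity_rule :: "('o, 'm) cat \<Rightarrow> 'o \<Rightarrow> 'm set \<times> 'm" where
  "reflexivity_rule C Y = ({}, pairing C (Ide C Y) (Ide C Y))"

text \<open>The parameters of the rule are the triples \<open>(x, y, z)\<close> of elements of \<open>Y\<close>.\<close>

definition transitivity_rule :: "('o, 'm) cat \<Rightarrow> 'o \<Rightarrow> 'm set \<times> 'm" where
  "transitivity_rule C Y =
     (let YY = prod_obj C Y Y; x = proj1 C Y YY;
          y = proj1 C Y Y \<cdot>\<^bsub>C\<^esub> proj2 C Y YY; z = proj2 C Y Y \<cdot>\<^bsub>C\<^esub> proj2 C Y YY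
      in ({pairing C x y, pairing C y z}, pairing C x z))"

definition symmetry_rule :: "('o, 'm) cat \<Rightarrow> 'o \<Rightarrow> 'm set \<times> 'm" where
  "symmetry_rule C Y =
     ({Ide C (prod_obj C Y Y)}, pairing C (proj2 C Y Y) (proj1 C Y Y))"

context category
begin

lemma Sub_class:
  assumes "is_mono C m" "Cod C m = B"
  shows "iso_over C B `` {m} \<in> Sub C B" "m \<in> iso_over C B `` {m}"
proof -
  have m: "m \<in> monos_into C B" using assms by (simp add: monos_into_def)
  then show "iso_over C B `` {m} \<in> Sub C B" unfolding Sub_def by (rule quotientI)
  show "m \<in> iso_over C B `` {m}" using equiv_class_self[OF equiv_iso_over m] .
qed

lemma Sub_hom:
  assumes "A \<in> Sub C X" "m \<in> A"
  shows "m \<in> hom C (Dom C m) X"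
  using mono_hom Sub_mono[OF assms] by blast

lemma Sub_factors_iff:
  assumes "A \<in> Sub C X" "m \<in> A" "n \<in> A"
  shows "factors C a m \<longleftrightarrow> factors C a n"
  using factors_trans Sub_factors assms Sub_mono unfolding is_mono_def by metis

end

context finitely_complete_category
begin

lemma reflexive_rel_iff:
  assumes Y: "Y \<in> Obj C" and S: "S \<in> Rel C Y" and s: "s \<in> S"
  shows "reflexive_rel C Y S \<longleftrightarrow> closed_under C s (reflexivity_rule C Y)"
proof -
  let ?d = "pairing C (Ide C Y) (Ide C Y)"
  note S' = S[unfolded Rel_def]
  note d = Sub_class[OF pairing_mono[OF Y], folded diag_rel_def]
  have "reflexive_rel C Y S \<longleftrightarrow> factors C ?d s"
    unfolding reflexive_rel_def using sub_le_iff[OF d(1) S' d(2) s] .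
  also have "\<dots> \<longleftrightarrow> closed_under C s ({}, ?d)"
    using closed_under_axiom_iff[OF pairing(1)[OF Ide_hom[OF Y] Ide_hom[OF Y]]] Sub_mono[OF S' s] by blast
  finally show ?thesis by (simp add: reflexivity_rule_def)
qed

lemma symmetric_rel_iff:
  assumes Y: "Y \<in> Obj C" and S: "S \<in> Rel C Y" and s: "s \<in> S"
  shows "symmetric_rel C Y S \<longleftrightarrow> closed_under C s (symmetry_rule C Y)"
proof -
  let ?tw = "pairing C (proj2 C Y Y) (proj1 C Y Y)" and ?YY = "prod_obj C Y Y"
  note S' = S[unfolded Rel_def] and pi = proj_hom[OF Y Y]
  note sh = Sub_hom[OF S' s]
  have tw: "?tw \<in> hom C ?YY ?YY" using pairing(1)[OF pi(2,1)] .
  have "symmetric_rel C Y S \<longleftrightarrow> factors C (?tw \<cdot> s) s"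
  proof
    assume "symmetric_rel C Y S"
    then obtain r n where r: "r \<in> S" "n \<in> S" "factors C (?tw \<cdot> r) n"
      unfolding symmetric_rel_def sub_le_def op_rel_def by blast
    have "factors C (?tw \<cdot> s) (?tw \<cdot> r)"
      using factors_comp[OF Sub_factors[OF S' s r(1)] Sub_hom[OF S' r(1)] tw] .
    then have "factors C (?tw \<cdot> s) n"
      using factors_trans r(3) homD(1)[OF Sub_hom[OF S' r(2)]] by blast
    then show "factors C (?tw \<cdot> s) s" using Sub_factors_iff[OF S' r(2) s] by blast
  next
    assume "factors C (?tw \<cdot> s) s"
    then show "symmetric_rel C Y S"
      using s unfolding symmetric_rel_def sub_le_def op_rel_def by blast
  qed
  also have "\<dots> \<longleftrightarrow> closed_under C s (symmetry_rule C Y)"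
  proof
    assume tws: "factors C (?tw \<cdot> s) s"
    have "factors C (?tw \<cdot> t) s" if t: "t \<in> hom C W ?YY" and "factors C t s" for W t
    proof -
      have "factors C (?tw \<cdot> t) (?tw \<cdot> s)" using factors_comp[OF that(2) sh tw] .
      then show ?thesis using factors_trans tws homD(1)[OF sh] by blast
    qed
    then show "closed_under C s (symmetry_rule C Y)"
      using Ide_Comp homD(2)[OF tw] by (simp add: closed_under_def symmetry_rule_def)
  next
    assume "closed_under C s (symmetry_rule C Y)"
    then show "factors C (?tw \<cdot> s) s"
      using sh Ide_Comp[OF sh] factors_refl[OF homD(1)[OF sh]] homD(2)[OF tw]
      unfolding closed_under_def symmetry_rule_def by auto
  qed
  finally show ?thesis .
qed

text \<open>
  The object of triples interchanges a generalized element \<open>t\<close> with its three components, which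
  lets the rule be read off on arbitrary \<open>a\<close>, \<open>b\<close>, \<open>c\<close>.
\<close>

lemma transitivity_rule_hom:
  assumes Y: "Y \<in> Obj C"
  defines "YY \<equiv> prod_obj C Y Y" and "T \<equiv> prod_obj C Y (prod_obj C Y Y)"
  obtains u v w where "transitivity_rule C Y = ({u, v}, w)"
    "u \<in> hom C T YY" "v \<in> hom C T YY" "w \<in> hom C T YY"
    "\<And>W a b c. a \<in> hom C W Y \<Longrightarrow> b \<in> hom C W Y \<Longrightarrow> c \<in> hom C W Y \<Longrightarrow>
       \<exists>t \<in> hom C W T. u \<cdot> t = pairing C a b \<and> v \<cdot> t = pairing C b c \<and> w \<cdot> t = pairing C a c"
    "\<And>W t. t \<in> hom C W T \<Longrightarrow> \<exists>a \<in> hom C W Y. \<exists>b \<in> hom C W Y. \<exists>c \<in> hom C W Y.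
       u \<cdot> t = pairing C a b \<and> v \<cdot> t = pairing C b c \<and> w \<cdot> t = pairing C a c"
proof -
  note pi = proj_hom[OF Y Y]
  note pi3 = proj_hom[OF Y pi(3)]
  let ?x = "proj1 C Y YY" and ?y = "proj1 C Y Y \<cdot> proj2 C Y YY" and ?z = "proj2 C Y Y \<cdot> proj2 C Y YY"
  have h: "?x \<in> hom C T Y" "?y \<in> hom C T Y" "?z \<in> hom C T Y"
    unfolding YY_def T_def using pi3(1) Comp_hom[OF pi3(2) pi(1)] Comp_hom[OF pi3(2) pi(2)] by simp_all
  have comps: "pairing C ?x ?y \<cdot> t = pairing C (?x \<cdot> t) (?y \<cdot> t)"
    "pairing C ?y ?z \<cdot> t = pairing C (?y \<cdot> t) (?z \<cdot> t)"
    "pairing C ?x ?z \<cdot> t = pairing C (?x \<cdot> t) (?z \<cdot> t)" if "t \<in> hom C W T" for W t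
    using pairing_Comp h that by blast+
  show ?thesis
  proof (rule that)
    show "transitivity_rule C Y = ({pairing C ?x ?y, pairing C ?y ?z}, pairing C ?x ?z)"
      by (simp add: transitivity_rule_def Let_def YY_def)
    show "pairing C ?x ?y \<in> hom C T YY" "pairing C ?y ?z \<in> hom C T YY" "pairing C ?x ?z \<in> hom C T YY"
      using pairing(1) h unfolding YY_def by blast+
  next
    fix W a b c assume abc: "a \<in> hom C W Y" "b \<in> hom C W Y" "c \<in> hom C W Y"
    note bc = pairing[OF abc(2,3)]
    note t = pairing[OF abc(1) bc(1)]
    let ?t = "pairing C a (pairing C b c)"
    have tT: "?t \<in> hom C W T" using t(1) by (simp add: T_def)
    have e: "?x \<cdot> ?t = a" "?y \<cdot> ?t = b" "?z \<cdot> ?t = c"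
      unfolding YY_def using t(2,3) bc(2,3) Comp_assoc[OF t(1) pi3(2) pi(1)]
        Comp_assoc[OF t(1) pi3(2) pi(2)] by simp_all
    show "\<exists>t \<in> hom C W T. pairing C ?x ?y \<cdot> t = pairing C a b \<and>
        pairing C ?y ?z \<cdot> t = pairing C b c \<and> pairing C ?x ?z \<cdot> t = pairing C a c"
      by (rule bexI[OF _ tT]) (simp add: comps[OF tT] e)
  next
    fix W t assume t: "t \<in> hom C W T"
    show "\<exists>a \<in> hom C W Y. \<exists>b \<in> hom C W Y. \<exists>c \<in> hom C W Y. pairing C ?x ?y \<cdot> t = pairing C a b \<and>
        pairing C ?y ?z \<cdot> t = pairing C b c \<and> pairing C ?x ?z \<cdot> t = pairing C a c"
      using comps[OF t] Comp_hom[OF t h(1)] Comp_hom[OF t h(2)] Comp_hom[OF t h(3)] by blast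
  qed
qed

lemma closed_under_transitivity_iff:
  assumes Y: "Y \<in> Obj C"
  shows "closed_under C s (transitivity_rule C Y) \<longleftrightarrow>
    (\<forall>W. \<forall>a \<in> hom C W Y. \<forall>b \<in> hom C W Y. \<forall>c \<in> hom C W Y.
       factors C (pairing C a b) s \<longrightarrow> factors C (pairing C b c) s \<longrightarrow> factors C (pairing C a c) s)"
    (is "_ \<longleftrightarrow> ?R")
proof -
  let ?YY = "prod_obj C Y Y" and ?T = "prod_obj C Y (prod_obj C Y Y)"
  obtain u v w where eq: "transitivity_rule C Y = ({u, v}, w)" and w: "w \<in> hom C ?T ?YY"
    and to: "\<And>W a b c. a \<in> hom C W Y \<Longrightarrow> b \<in> hom C W Y \<Longrightarrow> c \<in> hom C W Y \<Longrightarrow>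
       \<exists>t \<in> hom C W ?T. u \<cdot> t = pairing C a b \<and> v \<cdot> t = pairing C b c \<and> w \<cdot> t = pairing C a c"
    and comps: "\<And>W t. t \<in> hom C W ?T \<Longrightarrow> \<exists>a \<in> hom C W Y. \<exists>b \<in> hom C W Y. \<exists>c \<in> hom C W Y.
       u \<cdot> t = pairing C a b \<and> v \<cdot> t = pairing C b c \<and> w \<cdot> t = pairing C a c"
    by (rule transitivity_rule_hom[OF Y]) blast
  have *: "closed_under C s (transitivity_rule C Y) \<longleftrightarrow> (\<forall>W. \<forall>t \<in> hom C W ?T.
      factors C (u \<cdot> t) s \<longrightarrow> factors C (v \<cdot> t) s \<longrightarrow> factors C (w \<cdot> t) s)"
    using homD(2)[OF w] by (auto simp: closed_under_def eq)
  show ?thesis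
  proof
    assume cl: "closed_under C s (transitivity_rule C Y)"
    show ?R
    proof (intro allI ballI impI)
      fix W a b c assume abc: "a \<in> hom C W Y" "b \<in> hom C W Y" "c \<in> hom C W Y"
        and f: "factors C (pairing C a b) s" "factors C (pairing C b c) s"
      obtain t where t: "t \<in> hom C W ?T" "u \<cdot> t = pairing C a b" "v \<cdot> t = pairing C b c" "w \<cdot> t = pairing C a c"
        using to[OF abc] by blast
      show "factors C (pairing C a c) s" using cl[unfolded *] t f by metis
    qed
  next
    assume r: ?R
    show "closed_under C s (transitivity_rule C Y)"
      unfolding *
    proof (intro allI ballI impI)
      fix W t assume t: "t \<in> hom C W ?T" and f: "factors C (u \<cdot> t) s" "factors C (v \<cdot> t) s"
      obtain a b c where abc: "a \<in> hom C W Y" "b \<in> hom C W Y" "c \<in> hom C W Y"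
        "u \<cdot> t = pairing C a b" "v \<cdot> t = pairing C b c" "w \<cdot> t = pairing C a c"
        using comps[OF t] by blast
      show "factors C (w \<cdot> t) s" using r abc f by metis
    qed
  qed
qed

end

context topos_category
begin

text \<open>
  The composite \<open>S \<circ> S\<close> is the image of the object of composable pairs, so \<open>S \<circ> S \<subseteq> S\<close> says that
  the end points of the generic composable pair are related by \<open>S\<close>; every other composable pair
  is obtained from the generic one by a change of stage.  For the converse an image must exist,
  because otherwise the set \<open>comp_rel C Y S S\<close> would be empty and could not be below \<open>S\<close>.
\<close>

lemma transitive_rel_iff:
  assumes Y: "Y \<in> Obj C" and S: "S \<in> Rel C Y" and s: "s \<in> S"
  shows "transitive_rel C Y S \<longleftrightarrow> closed_under C s (transitivity_rule C Y)"
    (is "_ \<longleftrightarrow> ?R")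
proof
  note S' = S[unfolded Rel_def] and pi = proj_hom[OF Y Y]
  let ?g = "\<lambda>r q r' q'. pairing C ((proj1 C Y Y \<cdot> r') \<cdot> q') ((proj2 C Y Y \<cdot> r) \<cdot> q)"
  {
    assume "transitive_rel C Y S"
    then obtain r r' p q m n where r: "r \<in> S" and r': "r' \<in> S" and n: "n \<in> S" and mn: "factors C m n"
      and pb: "is_pullback C (proj2 C Y Y \<cdot> r') (proj1 C Y Y \<cdot> r) p q"
      and im: "is_image C (?g r q r' p) m"
      unfolding transitive_rel_def sub_le_def comp_rel_def by blast
    note rh = Sub_hom[OF S' r] and rh' = Sub_hom[OF S' r'] and nh = Sub_hom[OF S' n]
    note f = Comp_hom[OF rh' pi(2)] and g = Comp_hom[OF rh pi(1)]
    note H = pullback_hom[OF pb f g]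
    note legs = Comp_hom[OF H(1) Comp_hom[OF rh' pi(1)]] Comp_hom[OF H(2) Comp_hom[OF rh pi(2)]]
    have gs: "factors C (?g r q r' p) s"
    proof -
      have "factors C (?g r q r' p) m" using im by (simp add: is_image_def)
      then have "factors C (?g r q r' p) n" using factors_trans mn homD(1)[OF nh] by blast
      then show ?thesis using Sub_factors_iff[OF S' n s] by blast
    qed
    show ?R
      unfolding closed_under_transitivity_iff[OF Y]
    proof (intro allI ballI impI)
      fix W a b c assume abc: "a \<in> hom C W Y" "b \<in> hom C W Y" "c \<in> hom C W Y"
        and "factors C (pairing C a b) s" "factors C (pairing C b c) s"
      then have "factors C (pairing C a b) r'" "factors C (pairing C b c) r"
        using Sub_factors_iff[OF S' s r'] Sub_factors_iff[OF S' s r] by blast+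
      then obtain h k where h: "h \<in> hom C W (Dom C r')" "r' \<cdot> h = pairing C a b"
        and k: "k \<in> hom C W (Dom C r)" "r \<cdot> k = pairing C b c"
        using factors_iff[OF pairing(1)[OF abc(1,2)] rh'] factors_iff[OF pairing(1)[OF abc(2,3)] rh] by blast
      have hk: "(proj1 C Y Y \<cdot> r') \<cdot> h = a" "(proj2 C Y Y \<cdot> r') \<cdot> h = b"
        "(proj1 C Y Y \<cdot> r) \<cdot> k = b" "(proj2 C Y Y \<cdot> r) \<cdot> k = c"
        using pairing(2,3)[OF abc(1,2)] pairing(2,3)[OF abc(2,3)] h(2) k(2)
          Comp_assoc[OF h(1) rh' pi(1)] Comp_assoc[OF h(1) rh' pi(2)]
          Comp_assoc[OF k(1) rh pi(1)] Comp_assoc[OF k(1) rh pi(2)] by simp_all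
      then obtain l where l: "l \<in> hom C W (Dom C p)" "p \<cdot> l = h" "q \<cdot> l = k"
        using pullback_univ[OF pb f g h(1) k(1)] by auto
      have "?g r q r' p \<cdot> l = pairing C a c"
        using pairing_Comp[OF legs l(1)] Comp_assoc[OF l(1) H(1) Comp_hom[OF rh' pi(1)]]
          Comp_assoc[OF l(1) H(2) Comp_hom[OF rh pi(2)]] l(2,3) hk by simp
      then show "factors C (pairing C a c) s"
        using factors_precomp[OF gs pairing(1)[OF legs] Sub_hom[OF S' s] l(1)] by simp
    qed
  next
    assume tr: ?R
    note sh = Sub_hom[OF S' s]
    note f = Comp_hom[OF sh pi(2)] and g = Comp_hom[OF sh pi(1)]
    obtain p q where pb: "is_pullback C (proj2 C Y Y \<cdot> s) (proj1 C Y Y \<cdot> s) p q"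
      using pullback_exists[OF f g] by blast
    note H = pullback_hom[OF pb f g]
    have s_comps: "s \<cdot> t = pairing C ((proj1 C Y Y \<cdot> s) \<cdot> t) ((proj2 C Y Y \<cdot> s) \<cdot> t)"
      if "t \<in> hom C W (Dom C s)" for W t
      using pairing_proj[OF Y Y Comp_hom[OF that sh]] Comp_assoc[OF that sh pi(1)]
        Comp_assoc[OF that sh pi(2)] by simp
    note legs = Comp_hom[OF H(1) g] Comp_hom[OF H(1) f] Comp_hom[OF H(2) f]
    have gs: "factors C (?g s q s p) s"
    proof -
      have "factors C (pairing C ((proj1 C Y Y \<cdot> s) \<cdot> p) ((proj2 C Y Y \<cdot> s) \<cdot> p)) s"
        using factorsI[OF H(1) sh] s_comps[OF H(1)] by simp
      moreover have "factors C (pairing C ((proj2 C Y Y \<cdot> s) \<cdot> p) ((proj2 C Y Y \<cdot> s) \<cdot> q)) s"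
        using factorsI[OF H(2) sh] s_comps[OF H(2)] H(3) by simp
      ultimately show ?thesis
        using tr[unfolded closed_under_transitivity_iff[OF Y]] legs by blast
    qed
    obtain m where m: "is_image C (?g s q s p) m" using image_exists[OF pairing(1)[OF legs(1,3)]] by blast
    then have "factors C m s"
      using gs Sub_mono[OF S' s] homD(3)[OF pairing(1)[OF legs(1,3)]] by (simp add: is_image_def)
    moreover have "m \<in> comp_rel C Y S S" using s pb m unfolding comp_rel_def by blast
    ultimately show "transitive_rel C Y S" using s unfolding transitive_rel_def sub_le_def by blast
  }
qed

end

section \<open>Cocartesian lifts\<close>

context topos_category
begin

text \<open>
  The lift of \<open>g\<close> at \<open>(X, R)\<close> is the least relation closed under these rules together
  with the rule without premises that forces the direct image of \<open>R\<close> along \<open>g \<times> g\<close> into it.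
\<close>

theorem cofibration_of_horn_rules:
  assumes Rel: "\<And>Y S. P Y S \<Longrightarrow> S \<in> Rel C Y"
    and fin: "\<And>Y. Y \<in> Obj C \<Longrightarrow> finite (K Y)"
    and rules: "\<And>Y \<rho>. Y \<in> Obj C \<Longrightarrow> \<rho> \<in> K Y \<Longrightarrow> is_rule C (prod_obj C Y Y) \<rho>"
    and P: "\<And>Y S s. Y \<in> Obj C \<Longrightarrow> S \<in> Rel C Y \<Longrightarrow> s \<in> S \<Longrightarrow>
        P Y S \<longleftrightarrow> (\<forall>\<rho>\<in>K Y. closed_under C s \<rho>)"
  shows "cofibration (rel_cat P C) C ground"
  unfolding cofibration_def
proof (intro ballI)
  fix A Y g assume A: "A \<in> Obj (rel_cat P C)" and Y: "Y \<in> Obj C" and g: "g \<in> hom C (FObj ground A) Y"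
  obtain X R where A_eq: "A = (X, R)" by (cases A)
  have X: "X \<in> Obj C" and PR: "P X R" using A by (simp_all add: A_eq rel_cat_simps)
  have g: "g \<in> hom C X Y" using g by (simp add: A_eq ground_def)
  obtain r where r: "r \<in> R" using Sub_ex Rel[OF PR] unfolding Rel_def by blast
  let ?YY = "prod_obj C Y Y" and ?gr = "prod_map C g g \<cdot> r"
  note YY = proj_hom(3)[OF Y Y]
  have gr: "?gr \<in> hom C (Dom C r) ?YY"
    using Comp_hom[OF Sub_hom[OF Rel[OF PR, unfolded Rel_def] r] prod_map(1)[OF g g]] .
  have "is_rule C ?YY ({}, ?gr)" using gr homD(2)[OF gr] by (simp add: is_rule_def)
  then have rules': "is_rule C ?YY \<rho>" if "\<rho> \<in> insert ({}, ?gr) (K Y)" for \<rho>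
    using that rules[OF Y] by blast
  have "finite (insert ({}, ?gr) (K Y))" using fin[OF Y] by simp
  then obtain s where s: "is_mono C s" "Cod C s = ?YY"
    "\<And>\<rho>. \<rho> \<in> insert ({}, ?gr) (K Y) \<Longrightarrow> closed_under C s \<rho>"
    and least: "\<And>n. is_mono C n \<Longrightarrow> Cod C n = ?YY \<Longrightarrow>
      (\<And>\<rho>. \<rho> \<in> insert ({}, ?gr) (K Y) \<Longrightarrow> closed_under C n \<rho>) \<Longrightarrow> factors C s n"
    using least_closed_subobject[OF YY _ rules'] by blast
  define S where "S = iso_over C ?YY `` {s}"
  have S: "S \<in> Rel C Y" "s \<in> S" using Sub_class[OF s(1,2)] unfolding S_def Rel_def by blast+
  have PS: "P Y S" using P[OF Y S] s(3) by blast
  have RS: "sub_le C R (inv_rel C g S)"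
    using sub_le_inv_rel_iff[OF Rel[OF PR] S(1) g r S(2)] closed_under_axiom_iff[OF gr s(1,2)] s(3) by blast
  let ?f = "((X, R), g, (Y, S))"
  have f: "?f \<in> Arr (rel_cat P C)"
    using X PR Y PS g RS by (simp add: rel_cat_def)
  have "cocartesian (rel_cat P C) C ground ?f"
    unfolding cocartesian_def
  proof (intro conjI ballI impI f)
    fix \<phi> assume \<phi>: "\<phi> \<in> Arr (rel_cat P C)"
      and "Dom (rel_cat P C) \<phi> = Dom (rel_cat P C) ?f \<and> FArr ground \<phi> = FArr ground ?f"
    then obtain Y' T where \<phi>_eq: "\<phi> = ((X, R), g, (Y', T))"
      by (cases \<phi>) (auto simp: rel_cat_def ground_def)
    have *: "P Y' T" "g \<in> hom C X Y'" "sub_le C R (inv_rel C g T)"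
      using \<phi> by (simp_all add: \<phi>_eq rel_cat_def)
    have Y': "Y' = Y" using homD(3)[OF *(2)] homD(3)[OF g] by simp
    note PT = *(1)[unfolded Y'] and RT = *(3)
    note TR = Rel[OF PT, unfolded Rel_def]
    obtain t where t: "t \<in> T" using Sub_ex[OF TR] by blast
    note tm = Sub_mono[OF TR t]
    have "factors C ?gr t" using RT sub_le_inv_rel_iff[OF Rel[OF PR] Rel[OF PT] g r t] by simp
    then have "closed_under C t ({}, ?gr)" using closed_under_axiom_iff[OF gr] tm by blast
    then have "closed_under C t \<rho>" if "\<rho> \<in> insert ({}, ?gr) (K Y)" for \<rho>
      using that P[OF Y Rel[OF PT] t] PT by blast
    then have st: "factors C s t" using least tm by blast
    have "sub_le C S (inv_rel C (Ide C Y) T)"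
      using sub_le_inv_rel_iff[OF S(1) Rel[OF PT] Ide_hom[OF Y] S(2) t] st
        prod_map_Ide[OF Y Y] Ide_Comp[OF mono_hom[OF s(1,2)]] by simp
    then show "\<exists>!\<psi>. \<psi> \<in> hom (rel_cat P C) (Cod (rel_cat P C) ?f) (Cod (rel_cat P C) \<phi>) \<and>
        \<psi> \<cdot>\<^bsub>rel_cat P C\<^esub> ?f = \<phi> \<and> FArr ground \<psi> = Ide C (FObj ground (Cod (rel_cat P C) ?f))"
      using Y PS PT Ide_hom[OF Y] Ide_Comp[OF g]
      by (intro ex1I[of _ "((Y, S), Ide C Y, (Y, T))"])
        (auto simp: \<phi>_eq Y' rel_cat_def ground_def hom_def)
  qed
  then show "\<exists>f \<in> Arr (rel_cat P C). Dom (rel_cat P C) f = A \<and> FArr ground f = g \<and>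
      cocartesian (rel_cat P C) C ground f"
    using f by (intro bexI[of _ ?f]) (simp_all add: A_eq rel_cat_def ground_def)
qed

lemma is_rule_order_rules:
  assumes Y: "Y \<in> Obj C"
  shows "is_rule C (prod_obj C Y Y) (reflexivity_rule C Y)"
    "is_rule C (prod_obj C Y Y) (transitivity_rule C Y)"
    "is_rule C (prod_obj C Y Y) (symmetry_rule C Y)"
proof -
  note pi = proj_hom[OF Y Y]
  note d = pairing(1)[OF Ide_hom[OF Y] Ide_hom[OF Y]] and tw = pairing(1)[OF pi(2,1)]
  show "is_rule C (prod_obj C Y Y) (reflexivity_rule C Y)"
    using d homD(2)[OF d] by (simp add: is_rule_def reflexivity_rule_def)
  show "is_rule C (prod_obj C Y Y) (symmetry_rule C Y)"
    using tw homD(2)[OF tw] Ide_hom[OF pi(3)] by (simp add: is_rule_def symmetry_rule_def)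
  obtain u v w where uvw: "transitivity_rule C Y = ({u, v}, w)"
    "u \<in> hom C (prod_obj C Y (prod_obj C Y Y)) (prod_obj C Y Y)"
    "v \<in> hom C (prod_obj C Y (prod_obj C Y Y)) (prod_obj C Y Y)"
    "w \<in> hom C (prod_obj C Y (prod_obj C Y Y)) (prod_obj C Y Y)"
    by (rule transitivity_rule_hom[OF Y]) blast
  show "is_rule C (prod_obj C Y Y) (transitivity_rule C Y)"
    using uvw homD(2)[OF uvw(4)] by (simp add: is_rule_def)
qed

lemma cofibration_PrO: "cofibration (PrO C) C ground"
  unfolding PrO_def
  by (rule cofibration_of_horn_rules[where K = "\<lambda>Y. {reflexivity_rule C Y, transitivity_rule C Y}"])
    (auto simp: preorder_rel_def reflexive_rel_iff transitive_rel_iff is_rule_order_rules)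

lemma cofibration_Equ: "cofibration (Equ C) C ground"
  unfolding Equ_def
  by (rule cofibration_of_horn_rules[where
        K = "\<lambda>Y. {reflexivity_rule C Y, transitivity_rule C Y, symmetry_rule C Y}"])
    (auto simp: equivalence_rel_def preorder_rel_def reflexive_rel_iff transitive_rel_iff
      symmetric_rel_iff is_rule_order_rules)

end

theorem corollary4p3:
  fixes E :: "('o, 'm) cat"
  assumes "elementary_topos E"
    and "has_chain_suprema E"
  shows "cofibration (PrO E) E ground \<and> cofibration (Equ E) E ground"
proof -
  obtain t where "is_subobject_classifier E t" using assms(1) by (auto simp: elementary_topos_def)
  then interpret topos_category E t
    using assms(1)
    by (simp add: elementary_topos_def topos_category_def topos_category_axioms_def
        finitely_complete_category_def finitely_complete_category_axioms_def)
  show ?thesis using cofibration_PrO cofibration_Equ ..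
qed

end
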